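(* Let $(X_k)_{k\ge0}$ be a Markov chain in $(\mathsf X,\mathcal X)$ with transition kernel $Q$ and initial measure $\eta$ under the probability measure $\mathbb P^\eta$. Assume that the transition kernel $Q$ is $V$-uniformly ergodic, and denote by $\pi$ its unique invariant (probability) measure. Then there exists a constant $K$ such that $$\mathbb P^\eta\Big(\Big|\sum_{i=1}^n\{f(X_i)-\pi(f)\}\Big|\ge t\Big)\le K\,\eta(V)\,\exp\Big[-\frac1K\Big(\frac{t^2}{n|f|_\infty^2}\wedge\frac{t}{|f|_\infty}\Big)\Big]$$ for any probability measure $\eta$ on $(\mathsf X,\mathcal X)$, any bounded measurable function $f:\mathsf X\to\mathbb R$, any $t>0$ and any integer $n\ge1$.
   Context: $\mathsf X$ is a Polish space with Borel $\sigma$-field $\mathcal X$. $|f|_\infty$ is the supremum norm, $\pi(f)=\int f\,d\pi$, $\eta(V)=\int V\,d\eta\in[1,\infty]$, and $a\wedge b=\min(a,b)$; $c/0=+\infty$ for $c>0$. For measurable $V:\mathsf X\to[1,\infty)$, the kernel $Q$ is $V$-uniformly ergodic if it possesses an invariant probability measure $\pi$ and there are constants $R<\infty$, $\alpha>1$ such that $\|Q^m(x,\cdot)-\pi\|_V\le R\alpha^{-m}V(x)$ for every $x\in\mathsf X$, $m\in\mathbb N$, where $\|\mathbb P-\mathbb Q\|_V=\sup_{|f|\le V}|\int f\,d\mathbb P-\int f\,d\mathbb Q|$. *)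

theory Defs
  imports "HOL-Probability.Probability"
begin

definition markov_kernel :: "('a::polish_space \<Rightarrow> 'a measure) \<Rightarrow> bool" where
  "markov_kernel Q \<longleftrightarrow> Q \<in> borel \<rightarrow>\<^sub>M prob_algebra borel"

primrec kernel_power :: "('a::polish_space \<Rightarrow> 'a measure) \<Rightarrow> nat \<Rightarrow> 'a \<Rightarrow> 'a measure" where
  "kernel_power Q 0 = return borel"
| "kernel_power Q (Suc m) = (\<lambda>x. Q x \<bind> kernel_power Q m)"

definition invariant_prob :: "('a::polish_space \<Rightarrow> 'a measure) \<Rightarrow> 'a measure \<Rightarrow> bool" where
  "invariant_prob Q \<pi> \<longleftrightarrow> \<pi> \<in> space (prob_algebra borel) \<and> \<pi> \<bind> Q = \<pi>"

(* The supremum runs over those f for which both integrals are defined: the Bochner integral of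
   a non-integrable function is 0 by convention, so it must not be allowed to contribute. *)
definition V_norm :: "('a::polish_space \<Rightarrow> real) \<Rightarrow> 'a measure \<Rightarrow> 'a measure \<Rightarrow> ennreal" where
  "V_norm V P P' =
     (SUP f \<in> {f \<in> borel_measurable borel. (\<forall>x. \<bar>f x\<bar> \<le> V x) \<and> integrable P f \<and> integrable P' f}.
        ennreal \<bar>(\<integral>x. f x \<partial>P) - (\<integral>x. f x \<partial>P')\<bar>)"

definition V_uniformly_ergodic :: "('a::polish_space \<Rightarrow> real) \<Rightarrow> ('a \<Rightarrow> 'a measure) \<Rightarrow> bool" where
  "V_uniformly_ergodic V Q \<longleftrightarrow>
     (\<exists>\<pi>. invariant_prob Q \<pi> \<and>
       (\<exists>R \<alpha>::real. 0 \<le> R \<and> 1 < \<alpha> \<and>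
         (\<forall>x m. V_norm V (kernel_power Q m x) \<pi> \<le> ennreal (R / \<alpha> ^ m * V x))))"

definition natural_filtration ::
    "'w measure \<Rightarrow> (nat \<Rightarrow> 'w \<Rightarrow> 'a::topological_space) \<Rightarrow> nat \<Rightarrow> 'w measure" where
  "natural_filtration M X n = sigma (space M) (\<Union>i\<le>n. {X i -` A \<inter> space M |A. A \<in> sets borel})"

definition markov_chain ::
    "'w measure \<Rightarrow> (nat \<Rightarrow> 'w \<Rightarrow> 'a) \<Rightarrow> ('a::polish_space \<Rightarrow> 'a measure) \<Rightarrow> 'a measure \<Rightarrow> bool" where
  "markov_chain M X Q \<eta> \<longleftrightarrow>
     prob_space M \<and>
     (\<forall>n. X n \<in> M \<rightarrow>\<^sub>M borel) \<and>
     distr M borel (X 0) = \<eta> \<and>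
     (\<forall>n. \<forall>A \<in> sets borel. AE \<omega> in M.
        real_cond_exp M (natural_filtration M X n) (\<lambda>\<omega>. indicator A (X (Suc n) \<omega>)) \<omega>
          = measure (Q (X n \<omega>)) A)"

definition sup_norm :: "('a \<Rightarrow> real) \<Rightarrow> real" where
  "sup_norm f = (SUP x. \<bar>f x\<bar>)"

(* exp (- r) for r in [0, \<infinity>], with exp (- \<infinity>) = 0. *)
definition exp_neg :: "ennreal \<Rightarrow> ennreal" where
  "exp_neg r = (if r = \<infinity> then 0 else ennreal (exp (- enn2real r)))"

(* The division is that of ennreal, where c / 0 = \<infinity> for c > 0; hence the rate is \<infinity> for f = 0. *)
definition bernstein_rate :: "('a \<Rightarrow> real) \<Rightarrow> nat \<Rightarrow> real \<Rightarrow> ennreal" where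
  "bernstein_rate f n t =
     min (ennreal (t\<^sup>2) / ennreal (real n * (sup_norm f)\<^sup>2)) (ennreal t / ennreal (sup_norm f))"

lemma kernel_power_measurable:
  assumes "markov_kernel Q"
  shows "kernel_power Q m \<in> borel \<rightarrow>\<^sub>M prob_algebra borel"
proof (induction m)
  case 0
  then show ?case by simp
next
  case (Suc m)
  have "Q \<in> borel \<rightarrow>\<^sub>M prob_algebra borel"
    using assms by (simp add: markov_kernel_def)
  from measurable_bind_prob_space[OF this Suc] show ?case by simp
qed

lemma invariant_prob_bind_power:
  assumes Q: "markov_kernel Q" and p: "invariant_prob Q \<pi>"
  shows "\<pi> \<bind> kernel_power Q m = \<pi>"
proof (induction m)
  case 0
  have "sets \<pi> = sets borel"
    using p by (simp add: invariant_prob_def space_prob_algebra)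
  then show ?case by (simp add: bind_return'')
next
  case (Suc m)
  have s: "sets \<pi> = sets borel"
    using p by (simp add: invariant_prob_def space_prob_algebra)
  have 1: "Q \<in> \<pi> \<rightarrow>\<^sub>M subprob_algebra borel"
    unfolding measurable_cong_sets[OF s refl]
    using Q unfolding markov_kernel_def by (rule measurable_prob_algebraD)
  have 2: "kernel_power Q m \<in> borel \<rightarrow>\<^sub>M subprob_algebra borel"
    using kernel_power_measurable[OF Q] by (rule measurable_prob_algebraD)
  have "\<pi> \<bind> kernel_power Q (Suc m) = (\<pi> \<bind> Q) \<bind> kernel_power Q m"
    using bind_assoc[OF 1 2] by simp
  also have "\<dots> = \<pi>"
    using p Suc by (simp add: invariant_prob_def)
  finally show ?case .
qed

lemma V_norm_ge:
  assumes V: "\<And>x. 1 \<le> V x" and A: "A \<in> sets borel"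
    and P: "P \<in> space (prob_algebra borel)" and P': "P' \<in> space (prob_algebra borel)"
  shows "ennreal \<bar>measure P A - measure P' A\<bar> \<le> V_norm V P P'"
proof -
  interpret P: prob_space P using P by (simp add: space_prob_algebra)
  interpret P': prob_space P' using P' by (simp add: space_prob_algebra)
  have s[measurable_cong]: "sets P = sets borel" "sets P' = sets borel"
    using P P' by (auto simp: space_prob_algebra)
  have "ennreal \<bar>(\<integral>x. indicator A x \<partial>P) - (\<integral>x. indicator A x \<partial>P')\<bar> \<le> V_norm V P P'"
    unfolding V_norm_def
  proof (rule SUP_upper, safe)
    show "\<bar>indicator A x\<bar> \<le> V x" for x
      using V[of x] by (auto simp: indicator_def)
  qed (use A s in \<open>auto simp: less_top[symmetric]\<close>)
  moreover have "A \<inter> space P = A" "A \<inter> space P' = A"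
    using s by (auto dest: sets_eq_imp_space_eq)
  ultimately show ?thesis by simp
qed

theorem invariant_prob_unique:
  fixes V :: "'a::polish_space \<Rightarrow> real"
  assumes Q: "markov_kernel Q" and V: "\<And>x. 1 \<le> V x" and erg: "V_uniformly_ergodic V Q"
  shows "\<exists>!\<pi>. invariant_prob Q \<pi>"
proof -
  obtain \<pi> R \<alpha> where p: "invariant_prob Q \<pi>" and R: "0 \<le> R" and a: "1 < (\<alpha>::real)"
    and b: "\<And>x m. V_norm V (kernel_power Q m x) \<pi> \<le> ennreal (R / \<alpha> ^ m * V x)"
    using erg unfolding V_uniformly_ergodic_def by blast
  have pp: "\<pi> \<in> space (prob_algebra borel)" using p by (simp add: invariant_prob_def)
  have ke: "kernel_power Q m x \<in> space (prob_algebra borel)" for m x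
    using measurable_space[OF kernel_power_measurable[OF Q], of x m] by simp
  have "\<pi>' = \<pi>" if q: "invariant_prob Q \<pi>'" for \<pi>'
  proof (rule measure_eqI)
    have qq: "\<pi>' \<in> space (prob_algebra borel)" using q by (simp add: invariant_prob_def)
    interpret p: prob_space \<pi> using pp by (simp add: space_prob_algebra)
    interpret q: prob_space \<pi>' using qq by (simp add: space_prob_algebra)
    have s: "sets \<pi> = sets borel" "sets \<pi>' = sets borel"
      using pp qq by (auto simp: space_prob_algebra)
    then show "sets \<pi>' = sets \<pi>" by simp
    fix A assume "A \<in> sets \<pi>'"
    then have A: "A \<in> sets borel" using s by simp
    have lim: "(\<lambda>m. measure (kernel_power Q m x) A) \<longlonglongrightarrow> measure \<pi> A" for x
    proof -
      have bd: "\<bar>measure (kernel_power Q m x) A - measure \<pi> A\<bar> \<le> R * V x * (1 / \<alpha>) ^ m" for m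
      proof -
        have "ennreal \<bar>measure (kernel_power Q m x) A - measure \<pi> A\<bar> \<le> ennreal (R / \<alpha> ^ m * V x)"
          by (rule order_trans[OF V_norm_ge[OF V A ke pp] b])
        moreover have "0 \<le> R / \<alpha> ^ m * V x"
          using R a V[of x] by simp
        ultimately have "\<bar>measure (kernel_power Q m x) A - measure \<pi> A\<bar> \<le> R / \<alpha> ^ m * V x"
          by (simp only: ennreal_le_iff)
        also have "\<dots> = R * V x * (1 / \<alpha>) ^ m"
          by (simp add: power_one_over)
        finally show ?thesis .
      qed
      have "(\<lambda>m. (1 / \<alpha>) ^ m) \<longlonglongrightarrow> 0"
        using a by (intro LIMSEQ_realpow_zero) simp_all
      then have lim0: "(\<lambda>m. R * V x * (1 / \<alpha>) ^ m) \<longlonglongrightarrow> 0"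
        by (rule tendsto_mult_right_zero)
      have "(\<lambda>m. measure (kernel_power Q m x) A - measure \<pi> A) \<longlonglongrightarrow> 0"
        by (rule Lim_null_comparison[OF _ lim0]) (simp add: bd)
      then show ?thesis by (rule LIM_zero_cancel)
    qed
    have km: "kernel_power Q m \<in> \<pi>' \<rightarrow>\<^sub>M subprob_algebra borel" for m
      unfolding measurable_cong_sets[OF s(2) refl]
      using kernel_power_measurable[OF Q] by (rule measurable_prob_algebraD)
    have mm: "(\<lambda>x. measure (kernel_power Q m x) A) \<in> borel_measurable \<pi>'" for m
      using measurable_compose[OF km measurable_measure_subprob_algebra[OF A]] .
    have le1: "measure (kernel_power Q m x) A \<le> 1" for m x
      using ke[of m x] by (simp add: space_prob_algebra prob_space.prob_le_1)
    have eq: "(\<integral>x. measure (kernel_power Q m x) A \<partial>\<pi>') = measure \<pi>' A" for m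
    proof -
      have "measure (\<pi>' \<bind> kernel_power Q m) A = (\<integral>x. measure (kernel_power Q m x) A \<partial>\<pi>')"
        by (rule q.measure_bind[OF km A])
      then show ?thesis using invariant_prob_bind_power[OF Q q, of m] by simp
    qed
    have "(\<lambda>m. \<integral>x. measure (kernel_power Q m x) A \<partial>\<pi>') \<longlonglongrightarrow> (\<integral>x. measure \<pi> A \<partial>\<pi>')"
      by (rule integral_dominated_convergence[where w = "\<lambda>_. 1"]) (use mm lim le1 in auto)
    then have "(\<lambda>m::nat. measure \<pi>' A) \<longlonglongrightarrow> measure \<pi> A"
      by (simp add: eq q.prob_space)
    then have "measure \<pi>' A = measure \<pi> A"
      by (simp add: LIMSEQ_const_iff)
    then show "emeasure \<pi>' A = emeasure \<pi> A"
      by (simp add: p.emeasure_eq_measure q.emeasure_eq_measure)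
  qed
  with p show ?thesis by blast
qed

end

theory Submission
  imports Defs
begin

text \<open>
  Let \<open>g = f - \<pi>(f)\<close> and \<open>F = |f|\<^sub>\<infinity>\<close>. Ergodicity bounds \<open>|Q\<^sup>k g|\<close> both by \<open>2 F\<close> and by
  \<open>F R \<alpha>\<^sup>-\<^sup>k V\<close>, hence by the geometric mean of the two, which is \<open>O(F \<alpha>\<^sup>-\<^sup>k\<^sup>/\<^sup>2 V\<^sup>1\<^sup>/\<^sup>2)\<close>. So the solution
  \<open>u = Q g + Q\<^sup>2 g + \<dots>\<close> of the Poisson equation \<open>Q(g + u) = u\<close> is \<open>O(F V\<^sup>1\<^sup>/\<^sup>2)\<close>, and its square
  is controlled by \<open>V\<close>.
  Let \<open>U\<close> be a Lyapunov function comparable to \<open>V\<close> with \<open>Q U \<le> \<rho> U + b\<close>, and let \<open>s = |\<theta>| F\<close> be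
  small. For \<open>A\<close> large the function \<open>W = 1 + \<theta> u + A s\<^sup>2 U\<close> is at least \<open>1/2\<close> and satisfies
  \<open>Q(e\<^sup>\<theta>\<^sup>g W) \<le> (1 + c s\<^sup>2) W\<close>: the first-order terms cancel by the Poisson equation, and the
  second-order ones, of size \<open>s\<^sup>2 V\<close>, are absorbed by the contraction of \<open>U\<close>. Iterating along the
  chain bounds \<open>E exp(\<theta> \<Sum> g(X\<^sub>i))\<close> by a multiple of \<open>\<eta>(V) exp(c s\<^sup>2 n)\<close> for \<open>s \<le> s\<^sub>0\<close>, and
  Chernoff's inequality with \<open>\<theta> = min (s\<^sub>0 / F) (t / (2 c n F\<^sup>2))\<close> concludes.
\<close>

subsection \<open>Multiplicative functionals of Markov chains\<close>

lemma natural_filtration_basics: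
  fixes X :: "nat \<Rightarrow> 'w \<Rightarrow> 'a::topological_space"
  shows space_natural_filtration: "space (natural_filtration M X n) = space M"
    and sets_natural_filtration: "sets (natural_filtration M X n)
      = sigma_sets (space M) (\<Union>i\<le>n. {X i -` A \<inter> space M |A. A \<in> sets borel})"
proof -
  have "(\<Union>i\<le>n. {X i -` A \<inter> space M |A. A \<in> sets borel}) \<subseteq> Pow (space M)"
    by auto
  then show "space (natural_filtration M X n) = space M"
    and "sets (natural_filtration M X n)
      = sigma_sets (space M) (\<Union>i\<le>n. {X i -` A \<inter> space M |A. A \<in> sets borel})"
    by (simp_all add: natural_filtration_def space_measure_of sets_measure_of)
qed

lemma subalgebra_natural_filtration:
  assumes "\<And>n. X n \<in> M \<rightarrow>\<^sub>M borel"
  shows "subalgebra M (natural_filtration M X n)"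
  unfolding subalgebra_def natural_filtration_basics
  using assms by (auto intro!: sets.sigma_sets_subset measurable_sets)

lemma measurable_natural_filtration:
  assumes "i \<le> n"
  shows "X i \<in> natural_filtration M X n \<rightarrow>\<^sub>M borel"
  using assms by (intro measurableI) (auto simp: natural_filtration_basics)

text \<open>Both sides integrate \<open>\<phi>\<close> over the state space: against the law of
  \<open>X (Suc n)\<close> under \<open>M\<close> reweighted by \<open>Y\<close>, and against the
  mixture of the kernels \<open>Q (X n \<omega>)\<close> under the same reweighting. The conditional
  probabilities identify the two measures on Borel sets, which settles every nonnegative
  \<open>\<phi>\<close> at once.\<close>

lemma markov_chain_nn_integral_step:
  fixes Q :: "'a::polish_space \<Rightarrow> 'a measure"
  assumes Q: "markov_kernel Q" and mc: "markov_chain M X Q \<eta>"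
    and Y: "Y \<in> borel_measurable (natural_filtration M X n)"
    and Y0: "\<And>\<omega>. 0 \<le> Y \<omega>" and Yb: "\<And>\<omega>. Y \<omega> \<le> (c::real)"
    and \<phi>: "\<phi> \<in> borel_measurable borel"
  shows "(\<integral>\<^sup>+\<omega>. ennreal (Y \<omega>) * \<phi> (X (Suc n) \<omega>) \<partial>M)
    = (\<integral>\<^sup>+\<omega>. ennreal (Y \<omega>) * (\<integral>\<^sup>+y. \<phi> y \<partial>Q (X n \<omega>)) \<partial>M)"
proof -
  let ?F = "natural_filtration M X n"
  have X[measurable]: "\<And>n. X n \<in> M \<rightarrow>\<^sub>M borel"
    and ce: "\<And>n A. A \<in> sets borel \<Longrightarrow> AE \<omega> in M.
        real_cond_exp M (natural_filtration M X n) (\<lambda>\<omega>. indicator A (X (Suc n) \<omega>)) \<omega>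
          = measure (Q (X n \<omega>)) A"
    and M: "prob_space M"
    using mc by (auto simp: markov_chain_def)
  interpret prob_space M by (rule M)
  have sub: "subalgebra M ?F" by (rule subalgebra_natural_filtration[OF X])
  interpret finite_measure_subalgebra M ?F by unfold_locales (rule sub)
  have YM[measurable]: "Y \<in> borel_measurable M" by (rule measurable_from_subalg[OF sub Y])
  have Qp[measurable]: "Q \<in> borel \<rightarrow>\<^sub>M subprob_algebra borel"
    using Q unfolding markov_kernel_def by (rule measurable_prob_algebraD)
  have Qprob: "prob_space (Q x)" for x
    using Q measurable_space[of Q borel "prob_algebra borel" x]
    by (simp add: markov_kernel_def space_prob_algebra)
  let ?D = "density M (\<lambda>\<omega>. ennreal (Y \<omega>))"
  have K: "(\<lambda>\<omega>. Q (X n \<omega>)) \<in> ?D \<rightarrow>\<^sub>M subprob_algebra borel"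
    by measurable
  have ne: "space ?D \<noteq> {}" by (simp add: not_empty)
  have "distr ?D borel (X (Suc n)) = ?D \<bind> (\<lambda>\<omega>. Q (X n \<omega>))"
  proof (rule measure_eqI)
    show s: "sets (distr ?D borel (X (Suc n))) = sets (?D \<bind> (\<lambda>\<omega>. Q (X n \<omega>)))"
      using sets_bind[OF sets_kernel[OF K] ne] by simp
    fix A assume "A \<in> sets (distr ?D borel (X (Suc n)))"
    then have A[measurable]: "A \<in> sets borel" by simp
    \<comment> \<open>The bound on \<open>Y\<close> makes this product integrable, as needed to move
      \<open>Y\<close> past the conditional expectation.\<close>
    have YA: "integrable M (\<lambda>\<omega>. Y \<omega> * indicator A (X (Suc n) \<omega>))"
    proof (intro integrable_const_bound[where B="\<bar>c\<bar>"] AE_I2)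
      show "norm (Y \<omega> * indicator A (X (Suc n) \<omega>)) \<le> \<bar>c\<bar>" for \<omega>
        using Y0[of \<omega>] Yb[of \<omega>] by (simp add: indicator_def)
    qed measurable
    have mQ: "(\<lambda>\<omega>. measure (Q (X n \<omega>)) A) \<in> borel_measurable M" by measurable
    have YQ: "integrable M (\<lambda>\<omega>. Y \<omega> * measure (Q (X n \<omega>)) A)"
    proof (intro integrable_const_bound[where B="\<bar>c\<bar>"] AE_I2)
      fix \<omega>
      have "Y \<omega> * measure (Q (X n \<omega>)) A \<le> c * 1"
        using Y0[of \<omega>] Yb[of \<omega>] by (intro mult_mono) (auto simp: prob_space.prob_le_1[OF Qprob])
      then show "norm (Y \<omega> * measure (Q (X n \<omega>)) A) \<le> \<bar>c\<bar>"
        using Y0[of \<omega>] by (simp add: abs_mult)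
    qed (use mQ in measurable)
    have "(\<integral>\<omega>. Y \<omega> * indicator A (X (Suc n) \<omega>) \<partial>M)
      = (\<integral>\<omega>. Y \<omega> * real_cond_exp M ?F (\<lambda>\<omega>. indicator A (X (Suc n) \<omega>)) \<omega> \<partial>M)"
      by (rule real_cond_exp_intg(2)[symmetric, OF YA Y]) measurable
    also have "\<dots> = (\<integral>\<omega>. Y \<omega> * measure (Q (X n \<omega>)) A \<partial>M)"
      using ce[OF A, of n] mQ by (intro integral_cong_AE) auto
    finally have eq: "(\<integral>\<omega>. Y \<omega> * indicator A (X (Suc n) \<omega>) \<partial>M)
      = (\<integral>\<omega>. Y \<omega> * measure (Q (X n \<omega>)) A \<partial>M)" .
    have "emeasure (distr ?D borel (X (Suc n))) A
      = (\<integral>\<^sup>+\<omega>. ennreal (Y \<omega>) * indicator (X (Suc n) -` A \<inter> space M) \<omega> \<partial>M)"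
      by (simp add: emeasure_distr emeasure_density)
    also have "\<dots> = (\<integral>\<^sup>+\<omega>. ennreal (Y \<omega> * indicator A (X (Suc n) \<omega>)) \<partial>M)"
      by (intro nn_integral_cong) (auto simp: indicator_def)
    also have "\<dots> = (\<integral>\<^sup>+\<omega>. ennreal (Y \<omega> * measure (Q (X n \<omega>)) A) \<partial>M)"
      using Y0 eq YA YQ by (subst (1 2) nn_integral_eq_integral) auto
    also have "\<dots> = (\<integral>\<^sup>+\<omega>. ennreal (Y \<omega>) * emeasure (Q (X n \<omega>)) A \<partial>M)"
      using Y0 by (intro nn_integral_cong)
        (simp add: ennreal_mult finite_measure.emeasure_eq_measure[OF prob_space.finite_measure[OF Qprob]])
    also have "\<dots> = (\<integral>\<^sup>+\<omega>. emeasure (Q (X n \<omega>)) A \<partial>?D)"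
      by (rule nn_integral_density[symmetric]) measurable
    also have "\<dots> = emeasure (?D \<bind> (\<lambda>\<omega>. Q (X n \<omega>))) A"
      by (rule emeasure_bind[symmetric, OF ne K A])
    finally show "emeasure (distr ?D borel (X (Suc n))) A = emeasure (?D \<bind> (\<lambda>\<omega>. Q (X n \<omega>))) A" .
  qed
  then have "(\<integral>\<^sup>+y. \<phi> y \<partial>distr ?D borel (X (Suc n))) = (\<integral>\<^sup>+y. \<phi> y \<partial>(?D \<bind> (\<lambda>\<omega>. Q (X n \<omega>))))"
    by simp
  then show ?thesis
    using \<phi> by (simp add: nn_integral_distr nn_integral_density nn_integral_bind[OF \<phi> K])
qed

text \<open>Induction on \<open>n\<close>: the factors up to time \<open>n\<close> depend on the
  past only, and \<open>step\<close> trades the factor at time \<open>Suc n\<close> for one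
  \<open>a\<close>. An upper bound on \<open>g\<close> suffices, because it already bounds the
  nonnegative weight. The sum starts at 1, so \<open>X 0\<close> enters only through the integral of
  \<open>W\<close> under \<open>\<eta>\<close>.\<close>

lemma markov_chain_exponential_moment:
  fixes Q :: "'a::polish_space \<Rightarrow> 'a measure" and g :: "'a \<Rightarrow> real"
  assumes Q: "markov_kernel Q" and mc: "markov_chain M X Q \<eta>"
    and g: "g \<in> borel_measurable borel" and gb: "\<And>x. g x \<le> c"
    and W: "W \<in> borel_measurable borel" and a: "0 \<le> a"
    and step: "\<And>x. (\<integral>\<^sup>+y. ennreal (exp (g y)) * W y \<partial>Q x) \<le> ennreal a * W x"
  shows "(\<integral>\<^sup>+\<omega>. ennreal (exp (\<Sum>i=1..n. g (X i \<omega>))) * W (X n \<omega>) \<partial>M)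
    \<le> ennreal (a ^ n) * (\<integral>\<^sup>+x. W x \<partial>\<eta>)"
proof (induction n)
  have X[measurable]: "\<And>n. X n \<in> M \<rightarrow>\<^sub>M borel" and eta: "distr M borel (X 0) = \<eta>"
    using mc by (auto simp: markov_chain_def)
  note [measurable] = g W
  {
    case 0
    show ?case by (simp add: eta[symmetric] nn_integral_distr)
  next
    case (Suc n)
    let ?Y = "\<lambda>\<omega>. exp (\<Sum>i=1..n. g (X i \<omega>))"
    have Y: "?Y \<in> borel_measurable (natural_filtration M X n)"
    proof -
      have "(\<lambda>\<omega>. \<Sum>i=1..n. g (X i \<omega>)) \<in> borel_measurable (natural_filtration M X n)"
        by (intro borel_measurable_sum measurable_compose[OF measurable_natural_filtration g]) auto
      then show ?thesis by measurable
    qed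
    have Yb: "?Y \<omega> \<le> exp (real n * c)" for \<omega>
      using sum_mono[of "{1..n}" "\<lambda>i. g (X i \<omega>)" "\<lambda>_. c"] gb by simp
    have "(\<integral>\<^sup>+\<omega>. ennreal (exp (\<Sum>i=1..Suc n. g (X i \<omega>))) * W (X (Suc n) \<omega>) \<partial>M)
      = (\<integral>\<^sup>+\<omega>. ennreal (?Y \<omega>) * (ennreal (exp (g (X (Suc n) \<omega>))) * W (X (Suc n) \<omega>)) \<partial>M)"
      by (intro nn_integral_cong) (simp add: exp_add ennreal_mult mult.assoc)
    also have "\<dots> = (\<integral>\<^sup>+\<omega>. ennreal (?Y \<omega>) * (\<integral>\<^sup>+y. ennreal (exp (g y)) * W y \<partial>Q (X n \<omega>)) \<partial>M)"
      by (rule markov_chain_nn_integral_step[OF Q mc Y _ Yb]) auto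
    also have "\<dots> \<le> (\<integral>\<^sup>+\<omega>. ennreal a * (ennreal (?Y \<omega>) * W (X n \<omega>)) \<partial>M)"
      by (intro nn_integral_mono order_trans[OF mult_left_mono[OF step]]) (auto simp: mult_ac)
    also have "\<dots> = ennreal a * (\<integral>\<^sup>+\<omega>. ennreal (?Y \<omega>) * W (X n \<omega>) \<partial>M)"
      by (rule nn_integral_cmult) measurable
    also have "\<dots> \<le> ennreal a * (ennreal (a ^ n) * (\<integral>\<^sup>+x. W x \<partial>\<eta>))"
      by (intro mult_left_mono Suc.IH) auto
    also have "\<dots> = ennreal (a ^ Suc n) * (\<integral>\<^sup>+x. W x \<partial>\<eta>)"
      using a by (simp add: ennreal_mult mult.assoc)
    finally show ?case .
  }
qed

subsection \<open>Integrability and elementary inequalities\<close>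

text \<open>\<open>V_norm\<close> tests only integrable functions, so ergodicity cannot be applied
  to \<open>V\<close> before its integrability is known. Truncations are bounded, hence admissible,
  and monotone convergence passes their common bound on to \<open>V\<close>.\<close>

lemma integrable_of_truncations:
  fixes V :: "'a \<Rightarrow> real"
  assumes P: "finite_measure P" and V: "V \<in> borel_measurable P" and V0: "\<And>x. 0 \<le> V x"
    and bd: "\<And>N::nat. (\<integral>x. min (V x) (real N) \<partial>P) \<le> c"
  shows "integrable P V" and "(\<integral>x. V x \<partial>P) \<le> c"
proof -
  interpret finite_measure P by (rule P)
  note [measurable] = V
  \<comment> \<open>Truncation at level 0 integrates to 0; the sign of \<open>c\<close> is needed to
    return from \<open>ennreal\<close> to real inequalities.\<close>
  have c0: "0 \<le> c"
    using bd[of 0] V0 by (simp add: min_absorb2)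
  have int: "integrable P (\<lambda>x. min (V x) (real N))" for N :: nat
    using V0 by (intro integrable_const_bound[where B="real N"]) auto
  have eq: "ennreal (V x) = (SUP N::nat. ennreal (min (V x) (real N)))" for x
  proof (rule antisym)
    obtain N :: nat where "V x \<le> real N" using real_arch_simple by blast
    then show "ennreal (V x) \<le> (SUP N::nat. ennreal (min (V x) (real N)))"
      by (intro SUP_upper2[of N]) auto
  qed (auto intro!: SUP_least ennreal_leI)
  have "(\<integral>\<^sup>+x. ennreal (V x) \<partial>P) = (SUP N::nat. \<integral>\<^sup>+x. ennreal (min (V x) (real N)) \<partial>P)"
    unfolding eq by (intro nn_integral_monotone_convergence_SUP)
      (auto simp: incseq_def le_fun_def intro!: ennreal_leI)
  also have "\<dots> \<le> ennreal c"
    using V0 bd by (intro SUP_least) (simp add: nn_integral_eq_integral[OF int] ennreal_leI)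
  finally have le: "(\<integral>\<^sup>+x. ennreal (V x) \<partial>P) \<le> ennreal c" .
  then show i: "integrable P V"
    using V0 by (intro integrableI_nonneg) (auto intro: le_less_trans)
  show "(\<integral>x. V x \<partial>P) \<le> c"
    using le V0 c0 by (simp add: nn_integral_eq_integral[OF i] ennreal_le_iff)
qed

lemma integrable_bounded_prob:
  fixes f :: "'a::topological_space \<Rightarrow> real"
  assumes "prob_space P" "sets P = sets borel" "f \<in> borel_measurable borel" "\<And>x. \<bar>f x\<bar> \<le> F"
  shows "integrable P f"
proof -
  interpret prob_space P by (rule assms)
  show ?thesis
    using assms by (intro integrable_const_bound[where B=F]) (auto cong: measurable_cong_sets)
qed

text \<open>For \<open>y = - x\<close> with \<open>x\<close> nonnegative, the Taylor lower bound for
  \<open>exp x\<close> times \<open>1 - x + x\<^sup>2\<close> equals 1 plus nonnegative terms;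
  dividing by \<open>exp x\<close> gives the claim.\<close>

lemma exp_le_quadratic:
  fixes y :: real
  assumes "\<bar>y\<bar> \<le> 1"
  shows "exp y \<le> 1 + y + y\<^sup>2"
proof (cases "0 \<le> y")
  case True
  then show ?thesis using assms exp_bound[of y] by simp
next
  case False
  define x where "x = - y"
  have x: "0 \<le> x" using False by (simp add: x_def)
  have "1 + x + x\<^sup>2 / 2 \<le> exp x" by (rule exp_lower_Taylor_quadratic[OF x])
  then have "(1 + x + x\<^sup>2 / 2) * (1 - x + x\<^sup>2) \<le> exp x * (1 - x + x\<^sup>2)"
    using assms x by (intro mult_right_mono) (auto simp: x_def)
  moreover have "(1 + x + x\<^sup>2 / 2) * (1 - x + x\<^sup>2) = 1 + (x ^ 2 + x ^ 3 + x ^ 4) / 2"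
    by (simp add: field_simps power2_eq_square power3_eq_cube power4_eq_xxxx)
  then have "1 \<le> (1 + x + x\<^sup>2 / 2) * (1 - x + x\<^sup>2)"
    using x by simp
  ultimately have "1 \<le> exp x * (1 - x + x\<^sup>2)" by simp
  then have "inverse (exp x) \<le> 1 - x + x\<^sup>2"
    by (simp add: field_simps)
  then show ?thesis by (simp add: x_def exp_minus)
qed

text \<open>Meant for \<open>y = \<theta> * g\<close> and \<open>z = \<theta> * u\<close>. The
  first-order part \<open>y + z\<close> is kept exactly, since the Poisson equation controls its
  integral; all else is collected in one multiple of \<open>s\<^sup>2 * U\<close>. The cross term
  \<open>(exp y - 1) * z\<close> is a product of two factors of order \<open>s\<close>.\<close>

lemma exp_perturbation_bound:
  fixes y z :: real
  assumes y: "\<bar>y\<bar> \<le> 2 * s" and z: "\<bar>z\<bar> \<le> s * B * v" and s: "0 \<le> s" "s \<le> 1/2"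
    and v: "1 \<le> v" "v \<le> U" and B: "0 \<le> B" and A: "0 \<le> A"
  shows "exp y * (1 + z + A * s\<^sup>2 * U) \<le> 1 + (y + z) + s\<^sup>2 * (4 * (1 + B) + A * exp (2 * s)) * U"
proof -
  have y1: "\<bar>y\<bar> \<le> 1" using y s by simp
  have y2: "y\<^sup>2 \<le> (2 * s)\<^sup>2" using power_mono[OF y, of 2] by simp
  have e: "exp y \<le> 1 + y + y\<^sup>2" by (rule exp_le_quadratic[OF y1])
  \<comment> \<open>As \<open>exp y - 1\<close> lies between \<open>y\<close> and
    \<open>y + y\<^sup>2\<close>, this bounds its modulus by
    \<open>2 * \<bar>y\<bar>\<close>.\<close>
  have "y\<^sup>2 \<le> \<bar>y\<bar>" using y1 mult_left_le[of "\<bar>y\<bar>" "\<bar>y\<bar>"] by (simp add: power2_eq_square)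
  then have "\<bar>exp y - 1\<bar> \<le> 2 * \<bar>y\<bar>"
    using e exp_ge_add_one_self[of y] by linarith
  then have "\<bar>exp y - 1\<bar> * \<bar>z\<bar> \<le> (4 * s) * (s * B * v)"
    using y z by (intro mult_mono) auto
  then have "(exp y - 1) * z \<le> 4 * s\<^sup>2 * B * v"
    using abs_ge_self[of "(exp y - 1) * z"] by (simp add: abs_mult power2_eq_square mult_ac)
  also have "\<dots> \<le> 4 * s\<^sup>2 * B * U"
    using v B by (intro mult_left_mono) auto
  finally have 1: "(exp y - 1) * z \<le> 4 * s\<^sup>2 * B * U" .
  have 2: "exp y \<le> 1 + y + 4 * s\<^sup>2 * U"
    using e y2 mult_left_mono[of 1 U "4 * s\<^sup>2"] v by (simp add: power_mult_distrib)
  have 3: "exp y * (A * s\<^sup>2 * U) \<le> exp (2 * s) * (A * s\<^sup>2 * U)"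
    using y A v by (intro mult_right_mono) auto
  from 1 2 3 show ?thesis by (simp add: algebra_simps)
qed

subsection \<open>Ergodic kernels\<close>

text \<open>The witnesses \<open>R\<close> and \<open>\<alpha>\<close> are fixed here, so that
  constants obtained below depend on them and on \<open>V\<close>, \<open>Q\<close>,
  \<open>\<pi>\<close>, but not on \<open>f\<close>, \<open>\<eta>\<close> or the chain.\<close>

locale ergodic_kernel =
  fixes V :: "'a::polish_space \<Rightarrow> real" and Q :: "'a \<Rightarrow> 'a measure" and \<pi> :: "'a measure"
    and R \<alpha> :: real
  assumes Q: "markov_kernel Q" and V[measurable]: "V \<in> borel_measurable borel"
    and V1: "\<And>x. 1 \<le> V x" and inv: "invariant_prob Q \<pi>"
    and R: "0 \<le> R" and \<alpha>: "1 < \<alpha>"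
    and erg: "\<And>x m. V_norm V (kernel_power Q m x) \<pi> \<le> ennreal (R / \<alpha> ^ m * V x)"
begin

lemma prob_space_kernel_power: "prob_space (kernel_power Q m x)"
  and sets_kernel_power[simp, measurable_cong]: "sets (kernel_power Q m x) = sets borel"
  using measurable_space[OF kernel_power_measurable[OF Q], of x m]
  by (simp_all add: space_prob_algebra)

lemma kernel_power_1: "kernel_power Q (Suc 0) x = Q x"
proof -
  have "sets (Q x) = sets borel"
    using measurable_space[OF Q[unfolded markov_kernel_def], of x] by (simp add: space_prob_algebra)
  then show ?thesis by (simp add: bind_return'')
qed

lemma prob_space_Q: "prob_space (Q x)" and sets_Q[simp, measurable_cong]: "sets (Q x) = sets borel"
  using prob_space_kernel_power[of "Suc 0" x] sets_kernel_power[of "Suc 0" x]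
  unfolding kernel_power_1 .

lemma prob_space_pi: "prob_space \<pi>" and sets_pi[simp, measurable_cong]: "sets \<pi> = sets borel"
  using inv by (auto simp: invariant_prob_def space_prob_algebra)

lemma kernel_power_subprob[measurable]: "kernel_power Q m \<in> borel \<rightarrow>\<^sub>M subprob_algebra borel"
  using kernel_power_measurable[OF Q] by (rule measurable_prob_algebraD)

text \<open>Boundedness by \<open>F\<close> only ensures integrability under both measures, hence
  membership in the supremum of \<open>V_norm\<close>; the estimate itself is free of
  \<open>F\<close>, which permits truncations of \<open>V\<close> at any level.\<close>

lemma ergodic_bound_dominated:
  assumes f: "f \<in> borel_measurable borel" and fV: "\<And>x. \<bar>f x\<bar> \<le> V x" and fF: "\<And>x. \<bar>f x\<bar> \<le> F"
  shows "\<bar>(\<integral>y. f y \<partial>kernel_power Q m x) - (\<integral>y. f y \<partial>\<pi>)\<bar> \<le> R / \<alpha> ^ m * V x"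
proof -
  have "ennreal \<bar>(\<integral>y. f y \<partial>kernel_power Q m x) - (\<integral>y. f y \<partial>\<pi>)\<bar> \<le> V_norm V (kernel_power Q m x) \<pi>"
    unfolding V_norm_def
    by (rule SUP_upper) (use f fV integrable_bounded_prob[OF _ _ f fF] prob_space_kernel_power prob_space_pi in auto)
  also note erg
  finally show ?thesis
    using R \<alpha> V1[of x] by (subst (asm) ennreal_le_iff) auto
qed

lemma ergodic_bound:
  assumes f: "f \<in> borel_measurable borel" and F: "0 < F" and fF: "\<And>x. \<bar>f x\<bar> \<le> F"
  shows "\<bar>(\<integral>y. f y \<partial>kernel_power Q m x) - (\<integral>y. f y \<partial>\<pi>)\<bar> \<le> F * (R / \<alpha> ^ m * V x)"
proof -
  have 1: "\<bar>f x / F\<bar> \<le> 1" for x using fF[of x] F by simp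
  have "\<bar>(\<integral>y. f y / F \<partial>kernel_power Q m x) - (\<integral>y. f y / F \<partial>\<pi>)\<bar> \<le> R / \<alpha> ^ m * V x"
    by (rule ergodic_bound_dominated[where F=1]) (use f 1 V1 in \<open>auto intro: order_trans\<close>)
  moreover have "(\<integral>y. f y / F \<partial>kernel_power Q m x) - (\<integral>y. f y / F \<partial>\<pi>)
      = ((\<integral>y. f y \<partial>kernel_power Q m x) - (\<integral>y. f y \<partial>\<pi>)) / F"
    by (simp add: diff_divide_distrib)
  ultimately show ?thesis using F by (simp add: field_simps)
qed

lemma integral_min_bound:
  "\<bar>(\<integral>y. min (V y) (real N) \<partial>kernel_power Q m x) - (\<integral>y. min (V y) (real N) \<partial>\<pi>)\<bar> \<le> R / \<alpha> ^ m * V x"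
proof (rule ergodic_bound_dominated)
  show "\<bar>min (V y) (real N)\<bar> \<le> V y" "\<bar>min (V y) (real N)\<bar> \<le> real N" for y
    using V1[of y] by auto
qed measurable

lemma integrable_pi_V: "integrable \<pi> V"
proof (rule integrable_of_truncations)
  fix N :: nat
  \<comment> \<open>At \<open>m = 0\<close> the kernel power is a Dirac measure, so ergodicity at
    one arbitrary point bounds all truncated integrals.\<close>
  show "(\<integral>y. min (V y) (real N) \<partial>\<pi>) \<le> V undefined + R * V undefined"
    using integral_min_bound[where N=N and m=0 and x=undefined] by (simp add: integral_return)
qed (use prob_space_pi V1 in \<open>auto intro: order_trans[OF zero_le_one] simp: prob_space.finite_measure\<close>)

lemma integrable_V: "integrable (kernel_power Q m x) V"
  and integral_V_le: "(\<integral>y. V y \<partial>kernel_power Q m x) \<le> (\<integral>y. V y \<partial>\<pi>) + R / \<alpha> ^ m * V x"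
proof -
  have *: "(\<integral>y. min (V y) (real N) \<partial>kernel_power Q m x) \<le> (\<integral>y. V y \<partial>\<pi>) + R / \<alpha> ^ m * V x" for N :: nat
  proof -
    have "(\<integral>y. min (V y) (real N) \<partial>\<pi>) \<le> (\<integral>y. V y \<partial>\<pi>)"
    proof (rule integral_mono[OF _ integrable_pi_V])
      show "integrable \<pi> (\<lambda>y. min (V y) (real N))"
        by (rule Bochner_Integration.integrable_bound[OF integrable_pi_V])
          (use V1 in \<open>auto intro: order_trans[OF zero_le_one] simp: abs_real_def\<close>)
    qed auto
    then show ?thesis using integral_min_bound[where N=N and m=m and x=x] by linarith
  qed
  have V0: "0 \<le> V y" for y using V1[of y] by simp
  show "integrable (kernel_power Q m x) V"
    by (rule integrable_of_truncations(1)[OF _ _ V0 *])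
      (auto simp: prob_space.finite_measure prob_space_kernel_power)
  show "(\<integral>y. V y \<partial>kernel_power Q m x) \<le> (\<integral>y. V y \<partial>\<pi>) + R / \<alpha> ^ m * V x"
    by (rule integrable_of_truncations(2)[OF _ _ V0 *])
      (auto simp: prob_space.finite_measure prob_space_kernel_power)
qed

lemma integrable_Q_of_le_V:
  assumes "f \<in> borel_measurable borel" "\<And>x. \<bar>f x\<bar> \<le> c * V x"
  shows "integrable (Q x) f"
proof (rule Bochner_Integration.integrable_bound)
  show "integrable (Q x) (\<lambda>y. c * V y)"
    using integrable_V[of "Suc 0" x] unfolding kernel_power_1 by simp
  show "AE y in Q x. norm (f y) \<le> norm (c * V y)"
    using assms(2) by (auto intro: order_trans[OF _ abs_ge_self])
qed (use assms(1) in measurable)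

lemma measurable_integral_kernel_power[measurable]:
  fixes f :: "'a \<Rightarrow> real"
  assumes "f \<in> borel_measurable borel"
  shows "(\<lambda>x. \<integral>y. f y \<partial>kernel_power Q m x) \<in> borel_measurable borel"
  using measurable_compose[OF kernel_power_subprob integral_measurable_subprob_algebra[OF assms]] .

lemma integral_Q_kernel_power_V:
  "(\<integral>y. (\<integral>z. V z \<partial>kernel_power Q m y) \<partial>Q x) = (\<integral>z. V z \<partial>kernel_power Q (Suc m) x)"
proof -
  have V0: "0 \<le> V y" for y using V1[of y] by simp
  have Qm: "kernel_power Q m \<in> Q x \<rightarrow>\<^sub>M subprob_algebra borel" by measurable
  have "(\<integral>\<^sup>+z. ennreal (V z) \<partial>kernel_power Q (Suc m) x)
      = (\<integral>\<^sup>+y. (\<integral>\<^sup>+z. ennreal (V z) \<partial>kernel_power Q m y) \<partial>Q x)"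
    by (simp add: nn_integral_bind[OF _ Qm])
  also have "\<dots> = (\<integral>\<^sup>+y. ennreal (\<integral>z. V z \<partial>kernel_power Q m y) \<partial>Q x)"
    using V0 by (simp add: nn_integral_eq_integral[OF integrable_V])
  finally have eq: "(\<integral>\<^sup>+z. ennreal (V z) \<partial>kernel_power Q (Suc m) x)
      = (\<integral>\<^sup>+y. ennreal (\<integral>z. V z \<partial>kernel_power Q m y) \<partial>Q x)" .
  \<comment> \<open>For nonnegative integrands \<open>integral_eq_nn_integral\<close> needs
    measurability only, so the Chapman-Kolmogorov identity transfers without integrability of the
    outer function.\<close>
  have "(\<integral>y. (\<integral>z. V z \<partial>kernel_power Q m y) \<partial>Q x)
      = enn2real (\<integral>\<^sup>+y. ennreal (\<integral>z. V z \<partial>kernel_power Q m y) \<partial>Q x)"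
    using V0 by (intro integral_eq_nn_integral) auto
  also have "\<dots> = (\<integral>z. V z \<partial>kernel_power Q (Suc m) x)"
    unfolding eq[symmetric] using V0
    by (intro integral_eq_nn_integral[symmetric])
      (auto simp del: kernel_power.simps cong: measurable_cong_sets)
  finally show ?thesis .
qed

lemma integral_Q_kernel_power_bounded:
  fixes f :: "'a \<Rightarrow> real"
  assumes f: "f \<in> borel_measurable borel" and F: "\<And>x. \<bar>f x\<bar> \<le> F"
  shows "(\<integral>y. (\<integral>z. f z \<partial>kernel_power Q m y) \<partial>Q x) = (\<integral>z. f z \<partial>kernel_power Q (Suc m) x)"
proof -
  have Qm: "kernel_power Q m \<in> Q x \<rightarrow>\<^sub>M subprob_algebra borel" by measurable
  show ?thesis
    unfolding kernel_power.simps
    by (rule integral_bind[symmetric, where B=F and B'=1, OF f _ Qm])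
      (auto simp: F prob_space.finite_measure prob_space_Q prob_space.emeasure_space_1[OF prob_space_kernel_power])
qed

end

section \<open>Lyapunov drift and the Poisson equation\<close>

context ergodic_kernel begin

text \<open>\<open>U\<close> sums the iterates of \<open>V\<close> with weights
  \<open>\<beta> ^ k\<close>, where \<open>\<beta> = sqrt \<alpha>\<close>. Integrating under
  \<open>Q\<close> shifts the index, so \<open>\<beta>\<close> times the result is \<open>U\<close>
  with \<open>V\<close> removed and \<open>\<beta> ^ m * v m\<close> added. By ergodicity the added
  term is at most a constant plus \<open>R / \<beta> ^ m * V\<close>, which the removed
  \<open>V\<close> covers once \<open>m\<close> is large; hence the rate
  \<open>1 / \<beta>\<close>.\<close>

lemma drift_condition:
  obtains U \<rho> b C where "U \<in> borel_measurable borel" "\<And>x. V x \<le> U x" "\<And>x. U x \<le> C * V x"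
    "0 < \<rho>" "\<rho> < 1" "0 \<le> b" "\<And>x. (\<integral>y. U y \<partial>Q x) \<le> \<rho> * U x + b"
proof -
  define \<beta> where "\<beta> = sqrt \<alpha>"
  have \<beta>: "1 < \<beta>" "\<beta> * \<beta> = \<alpha>" using \<alpha> by (simp_all add: \<beta>_def)
  define p where "p = (\<integral>y. V y \<partial>\<pi>)"
  have V0: "0 \<le> V y" for y using V1[of y] by simp
  have p: "0 \<le> p" unfolding p_def by (intro Bochner_Integration.integral_nonneg V0)
  define v where "v k x = (\<integral>y. V y \<partial>kernel_power Q k x)" for k x
  have v_le: "v k x \<le> p + R / \<alpha> ^ k * V x" for k x
    unfolding v_def p_def by (rule integral_V_le)
  have v0: "0 \<le> v k x" for k x
    unfolding v_def by (intro Bochner_Integration.integral_nonneg V0)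
  have v_0: "v 0 x = V x" for x
    by (simp add: v_def integral_return)
  have vm[measurable]: "v k \<in> borel_measurable borel" for k
    unfolding v_def by measurable
  have v_abs: "\<bar>v k x\<bar> \<le> (p + R) * V x" for k x
  proof -
    have "R / \<alpha> ^ k \<le> R"
      using R \<alpha> by (simp add: divide_le_eq mult_left_le one_le_power mult_le_cancel_left1)
    then have "R / \<alpha> ^ k * V x \<le> R * V x"
      by (intro mult_right_mono V0)
    moreover have "p \<le> p * V x" using mult_left_mono[OF V1[of x] p] by simp
    ultimately show ?thesis
      using v_le[of k x] v0[of k x] by (simp add: algebra_simps)
  qed
  have v_int: "integrable (Q x) (v k)" for k x
    by (rule integrable_Q_of_le_V[OF vm v_abs])
  have v_step: "(\<integral>y. v k y \<partial>Q x) = v (Suc k) x" for k x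
    unfolding v_def by (rule integral_Q_kernel_power_V)
  obtain n where n: "R < \<beta> ^ n"
    using real_arch_pow[OF \<beta>(1)] by blast
  \<comment> \<open>A positive \<open>m\<close> keeps the term \<open>k = 0\<close>, which is
    \<open>V\<close> itself, in the sum defining \<open>U\<close>.\<close>
  define m where "m = Suc n"
  have "\<beta> ^ n \<le> \<beta> ^ m"
    using \<beta>(1) by (intro power_increasing) (auto simp: m_def)
  then have m: "R \<le> \<beta> ^ m" using n by linarith
  define U where "U x = (\<Sum>k<m. \<beta> ^ k * v k x)" for x
  have Um: "U \<in> borel_measurable borel" unfolding U_def by measurable
  have U_ge: "V x \<le> U x" for x
    using member_le_sum[of 0 "{..<m}" "\<lambda>k. \<beta> ^ k * v k x"] v0 \<beta>(1)
    by (auto simp: U_def v_0 m_def)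
  have U_le: "U x \<le> ((\<Sum>k<m. \<beta> ^ k) * (p + R)) * V x" for x
    unfolding U_def sum_distrib_right mult.assoc
    using v_abs \<beta>(1) by (intro sum_mono mult_left_mono) (auto simp: abs_le_iff)
  have drift: "(\<integral>y. U y \<partial>Q x) \<le> 1 / \<beta> * U x + 1 / \<beta> * (\<beta> ^ m * p)" for x
  proof -
    have "\<beta> * (\<integral>y. U y \<partial>Q x) = (\<Sum>k<m. \<beta> ^ Suc k * v (Suc k) x)"
      unfolding U_def by (simp add: v_int v_step sum_distrib_left mult_ac)
    also have "\<dots> = U x - V x + \<beta> ^ m * v m x"
      using sum.lessThan_Suc_shift[of "\<lambda>k. \<beta> ^ k * v k x" m]
      by (simp add: U_def v_0)
    also have "\<beta> ^ m * v m x \<le> \<beta> ^ m * p + V x"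
    proof -
      have "\<beta> ^ m * v m x \<le> \<beta> ^ m * (p + R / \<alpha> ^ m * V x)"
        using \<beta>(1) by (intro mult_left_mono v_le) auto
      also have "\<dots> = \<beta> ^ m * p + R / \<beta> ^ m * V x"
        using \<beta>(1) by (simp add: \<beta>(2)[symmetric] power_mult_distrib field_simps)
      also have "R / \<beta> ^ m * V x \<le> V x"
        using m \<beta>(1) V0[of x] mult_right_mono[of "R / \<beta> ^ m" 1 "V x"] by (simp add: divide_le_eq)
      finally show ?thesis by simp
    qed
    finally have "\<beta> * (\<integral>y. U y \<partial>Q x) \<le> U x + \<beta> ^ m * p" by simp
    then show ?thesis using \<beta>(1) by (simp add: field_simps)
  qed
  show thesis
    by (rule that[OF Um U_ge U_le _ _ _ drift]) (use \<beta> p in auto)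
qed

text \<open>The second bound is the geometric mean of the first and of \<open>ergodic_bound\<close>.
  It gives up half of the exponential rate to replace \<open>V\<close> by its square root.\<close>

lemma kernel_power_deviation_bounds:
  assumes f: "f \<in> borel_measurable borel" and F: "0 < F" and fF: "\<And>x. \<bar>f x\<bar> \<le> F"
  shows "\<bar>(\<integral>y. f y \<partial>kernel_power Q k x) - (\<integral>y. f y \<partial>\<pi>)\<bar> \<le> 2 * F"
    and "\<bar>(\<integral>y. f y \<partial>kernel_power Q k x) - (\<integral>y. f y \<partial>\<pi>)\<bar>
      \<le> F * sqrt (2 * R) * (1 / sqrt \<alpha>) ^ k * sqrt (V x)" (is "\<bar>?d\<bar> \<le> ?b")
proof -
  have le: "\<bar>\<integral>y. f y \<partial>P\<bar> \<le> F" if "prob_space P" "sets P = sets borel" for P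
  proof -
    interpret prob_space P by fact
    have "norm (\<integral>y. f y \<partial>P) \<le> (\<integral>y. norm (f y) \<partial>P)" by (rule integral_norm_bound)
    also have "\<dots> \<le> (\<integral>y. F \<partial>P)"
      using integrable_bounded_prob[OF that f fF] fF by (intro integral_mono) auto
    finally show ?thesis by (simp add: prob_space)
  qed
  have 1: "\<bar>?d\<bar> \<le> 2 * F"
    using le[OF prob_space_kernel_power sets_kernel_power, of k x] le[OF prob_space_pi sets_pi]
    by linarith
  then show "\<bar>?d\<bar> \<le> 2 * F" .
  have "\<bar>?d\<bar>\<^sup>2 \<le> (2 * F) * (F * (R / \<alpha> ^ k * V x))"
    unfolding power2_eq_square
    using 1 ergodic_bound[OF f F fF, of k x] F by (intro mult_mono) auto
  also have "\<dots> = F\<^sup>2 * (sqrt (2 * R))\<^sup>2 * ((1 / sqrt \<alpha>)\<^sup>2) ^ k * (sqrt (V x))\<^sup>2"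
    using R \<alpha> V1[of x] by (simp add: power_divide power2_eq_square)
  also have "\<dots> = ?b\<^sup>2"
    by (simp only: power_mult_distrib power_mult[symmetric] mult.commute[of 2 k])
  finally show "\<bar>?d\<bar> \<le> ?b"
    by (rule power2_le_imp_le) (use F R \<alpha> V1[of x] in simp)
qed

text \<open>Truncating the series for the solution of the Poisson equation avoids any exchange of limits
  and integrals; the truncation error is made quadratic in \<open>s = \<bar>\<theta>\<bar> * F\<close> by the choice of \<open>N\<close>.\<close>

lemma approximate_poisson_solution:
  assumes f: "f \<in> borel_measurable borel" and F: "0 < F" and fF: "\<And>x. \<bar>f x\<bar> \<le> F" and s: "0 < s"
  defines "B \<equiv> sqrt (2 * R) / (1 - 1 / sqrt \<alpha>)"
  obtains u where "u \<in> borel_measurable borel" "\<And>x. \<bar>u x\<bar> \<le> F * B * sqrt (V x)"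
    "\<And>x. \<bar>(\<integral>y. f y - (\<integral>z. f z \<partial>\<pi>) + u y \<partial>Q x) - u x\<bar> \<le> s * (F * sqrt (2 * R) * sqrt (V x))"
proof -
  define r where "r = 1 / sqrt \<alpha>"
  have r: "0 < r" "r < 1" using \<alpha> by (auto simp: r_def)
  define d where "d k x = (\<integral>y. f y \<partial>kernel_power Q k x) - (\<integral>y. f y \<partial>\<pi>)" for k x
  have dm[measurable]: "d k \<in> borel_measurable borel" for k
    unfolding d_def using f by measurable
  have d_le: "\<bar>d k x\<bar> \<le> 2 * F" "\<bar>d k x\<bar> \<le> F * sqrt (2 * R) * r ^ k * sqrt (V x)" for k x
    using kernel_power_deviation_bounds[OF f F fF, of k x] by (simp_all add: d_def r_def)
  have d_int: "integrable (Q x) (d k)" for k x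
    by (rule integrable_bounded_prob[OF prob_space_Q sets_Q dm d_le(1)])
  have d_0: "d 0 x = f x - (\<integral>z. f z \<partial>\<pi>)" for x
    using f by (simp add: d_def integral_return)
  have d_step: "(\<integral>y. d k y \<partial>Q x) = d (Suc k) x" for k x
  proof -
    \<comment> \<open>Adding the constant back gives integrability of the uncentred iterate, so that
      the integral of the difference can be split.\<close>
    have "integrable (Q x) (\<lambda>y. d k y + (\<integral>z. f z \<partial>\<pi>))"
      using prob_space.finite_measure[OF prob_space_Q[of x]]
      by (intro Bochner_Integration.integrable_add d_int) (simp add: finite_measure.integrable_const)
    then have "integrable (Q x) (\<lambda>y. \<integral>z. f z \<partial>kernel_power Q k y)" by (simp add: d_def)
    then show ?thesis
      using prob_space.finite_measure[OF prob_space_Q[of x]]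
      unfolding d_def
      by (simp add: integral_Q_kernel_power_bounded[OF f fF] finite_measure.integrable_const
          prob_space.prob_space[OF prob_space_Q] del: kernel_power.simps)
  qed
  obtain N where N: "r ^ N < s"
    using real_arch_pow_inv[OF s r(2)] by blast
  define u where "u x = (\<Sum>k<N. d (Suc k) x)" for x
  have "u \<in> borel_measurable borel" unfolding u_def by measurable
  moreover have "\<bar>u x\<bar> \<le> F * B * sqrt (V x)" for x
  proof -
    have "\<bar>u x\<bar> \<le> (\<Sum>k<N. \<bar>d (Suc k) x\<bar>)" unfolding u_def by (rule sum_abs)
    also have "\<dots> \<le> (\<Sum>k<N. F * sqrt (2 * R) * sqrt (V x) * r ^ k)"
    proof (rule sum_mono)
      fix k
      have "\<bar>d (Suc k) x\<bar> \<le> F * sqrt (2 * R) * r ^ Suc k * sqrt (V x)" by (rule d_le)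
      also have "\<dots> \<le> F * sqrt (2 * R) * r ^ k * sqrt (V x)"
        using F R V1[of x] r power_decreasing[of k "Suc k" r]
        by (intro mult_right_mono mult_left_mono) auto
      finally show "\<bar>d (Suc k) x\<bar> \<le> F * sqrt (2 * R) * sqrt (V x) * r ^ k" by (simp add: mult_ac)
    qed
    also have "\<dots> = F * sqrt (2 * R) * sqrt (V x) * (\<Sum>k<N. r ^ k)"
      by (simp add: sum_distrib_left)
    also have "\<dots> \<le> F * sqrt (2 * R) * sqrt (V x) * (1 / (1 - r))"
    proof (rule mult_left_mono)
      have "(\<Sum>k<N. r ^ k) = (1 - r ^ N) / (1 - r)"
        using r by (simp add: sum_gp_strict)
      also have "\<dots> \<le> 1 / (1 - r)"
        using r by (intro divide_right_mono) auto
      finally show "(\<Sum>k<N. r ^ k) \<le> 1 / (1 - r)" .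
    qed (use F R V1[of x] in simp)
    finally show ?thesis by (simp add: B_def r_def mult_ac)
  qed
  moreover have "\<bar>(\<integral>y. f y - (\<integral>z. f z \<partial>\<pi>) + u y \<partial>Q x) - u x\<bar> \<le> s * (F * sqrt (2 * R) * sqrt (V x))" for x
  proof -
    \<comment> \<open>The centred \<open>f\<close> supplies the missing term \<open>d 0\<close>.
      Integrating under \<open>Q\<close> raises each index by one, which returns \<open>u x\<close>
      and a single surplus term \<open>d (Suc N) x\<close>.\<close>
    have "(\<lambda>y. f y - (\<integral>z. f z \<partial>\<pi>) + u y) = (\<lambda>y. \<Sum>k<Suc N. d k y)"
      by (simp add: sum.lessThan_Suc_shift u_def d_0 del: sum.lessThan_Suc)
    then have "(\<integral>y. f y - (\<integral>z. f z \<partial>\<pi>) + u y \<partial>Q x) = u x + d (Suc N) x"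
      by (simp add: d_int d_step u_def)
    moreover have "\<bar>d (Suc N) x\<bar> \<le> s * (F * sqrt (2 * R) * sqrt (V x))"
    proof -
      have "r ^ Suc N \<le> s" using N r power_decreasing[of N "Suc N" r] by linarith
      then have "r ^ Suc N * (F * sqrt (2 * R) * sqrt (V x)) \<le> s * (F * sqrt (2 * R) * sqrt (V x))"
        using F R V1[of x] by (intro mult_right_mono) auto
      then show ?thesis using d_le(2)[of "Suc N" x] by (simp add: mult_ac)
    qed
    ultimately show ?thesis by simp
  qed
  ultimately show thesis by (rule that)
qed

end

section \<open>The multiplicative one-step inequality\<close>

context ergodic_kernel begin

text \<open>The constants are chosen before \<open>f\<close>, \<open>F\<close> and
  \<open>\<theta>\<close>, which enter the estimates through
  \<open>s = \<bar>\<theta>\<bar> * F\<close>. After the expansion, the coefficient of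
  \<open>s\<^sup>2 * U x\<close> must come back to at most \<open>A\<close>; the constant left over
  from the drift goes into \<open>c\<close>.\<close>

lemma exponential_supermartingale:
  obtains s\<^sub>0 c C where "0 < s\<^sub>0" "0 < c" "0 < C"
    "\<And>f F \<theta>. \<lbrakk>f \<in> borel_measurable borel; 0 < F; \<And>x. \<bar>f x\<bar> \<le> F; \<theta> \<noteq> 0; \<bar>\<theta>\<bar> * F \<le> s\<^sub>0\<rbrakk> \<Longrightarrow>
      \<exists>W \<in> borel_measurable borel. (\<forall>x. 1/2 \<le> W x \<and> W x \<le> C * V x) \<and>
        (\<forall>x. (\<integral>\<^sup>+y. ennreal (exp (\<theta> * (f y - (\<integral>z. f z \<partial>\<pi>)))) * ennreal (W y) \<partial>Q x)
          \<le> ennreal (exp (c * (\<bar>\<theta>\<bar> * F)\<^sup>2)) * ennreal (W x))"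
proof -
  obtain U \<rho> b C where U[measurable]: "U \<in> borel_measurable borel"
    and VU: "\<And>x. V x \<le> U x" and UV: "\<And>x. U x \<le> C * V x"
    and \<rho>: "0 < \<rho>" "\<rho> < 1" and b: "0 \<le> b" and drift: "\<And>x. (\<integral>y. U y \<partial>Q x) \<le> \<rho> * U x + b"
    using drift_condition by metis
  define B0 where "B0 = sqrt (2 * R)"
  define B where "B = B0 / (1 - 1 / sqrt \<alpha>)"
  have B0: "0 \<le> B0" using R by (simp add: B0_def)
  have B: "0 \<le> B" using B0 \<alpha> by (simp add: B_def)
  define D where "D = 4 * (1 + B)"
  have D: "0 < D" using B by (simp add: D_def)
  \<comment> \<open>The summand \<open>B\<^sup>2\<close> keeps \<open>W\<close> above 1/2. The other
    one makes \<open>A * ((1 - \<rho>) / 2)\<close>, the margin left by the contraction of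
    \<open>U\<close>, cover the Poisson error \<open>B0\<close> and the expansion error
    \<open>D\<close>.\<close>
  define A where "A = B\<^sup>2 + 2 * (B0 + D) / (1 - \<rho>)"
  have A: "0 \<le> A" "B\<^sup>2 \<le> A"
    using B0 D \<rho> by (auto simp: A_def intro!: add_nonneg_nonneg divide_nonneg_pos)
  have A2: "B0 + D \<le> A * ((1 - \<rho>) / 2)"
  proof -
    have "A * ((1 - \<rho>) / 2) = B\<^sup>2 * ((1 - \<rho>) / 2) + (B0 + D)"
      using \<rho> by (simp add: A_def field_simps)
    then show ?thesis using \<rho> by simp
  qed
  \<comment> \<open>The 1/2 keeps the exponent \<open>\<theta> * g\<close> within [-1, 1]; the
    logarithm lets the factor \<open>exp (2 * s\<^sub>0)\<close> use up only half of the gap between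
    \<open>\<rho>\<close> and 1.\<close>
  define s\<^sub>0 where "s\<^sub>0 = min (1/2) (ln ((1 + \<rho>) / (2 * \<rho>)) / 2)"
  have "1 < (1 + \<rho>) / (2 * \<rho>)" using \<rho> by (simp add: field_simps)
  then have s0: "0 < s\<^sub>0" "s\<^sub>0 \<le> 1/2" by (auto simp: s\<^sub>0_def)
  have exp_s0: "exp (2 * s\<^sub>0) * \<rho> \<le> (1 + \<rho>) / 2"
  proof -
    have "exp (2 * s\<^sub>0) \<le> exp (ln ((1 + \<rho>) / (2 * \<rho>)))" by (simp add: s\<^sub>0_def)
    also have "\<dots> = (1 + \<rho>) / (2 * \<rho>)" using \<rho> by (intro exp_ln) simp
    finally have "exp (2 * s\<^sub>0) * \<rho> \<le> (1 + \<rho>) / (2 * \<rho>) * \<rho>"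
      using \<rho> by (intro mult_right_mono) auto
    then show ?thesis using \<rho> by simp
  qed
  define E where "E = exp (2 * s\<^sub>0)"
  \<comment> \<open>The factor 2 compensates for \<open>1/2 \<le> W x\<close> when the additive
    drift constant becomes a multiple of \<open>W x\<close>; the 1 makes \<open>c\<close> positive
    even if \<open>b = 0\<close>.\<close>
  define c where "c = 2 * (D + A * E) * b + 1"
  have C0: "0 \<le> C"
    using order_trans[OF VU UV, of undefined] V1[of undefined] by (smt (verit) mult_nonneg_nonneg zero_less_mult_iff)
  have c: "0 < c" using D A b by (simp add: c_def E_def add_nonneg_pos)
  show thesis
  proof (rule that[of s\<^sub>0 c "1 + B + A * C", OF s0(1) c])
    show "0 < 1 + B + A * C" using B A C0 by (simp add: add_pos_nonneg)
    fix f :: "'a \<Rightarrow> real" and F \<theta> :: real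
    assume f[measurable]: "f \<in> borel_measurable borel" and F: "0 < F" and fF: "\<And>x. \<bar>f x\<bar> \<le> F"
      and \<theta>: "\<theta> \<noteq> 0" "\<bar>\<theta>\<bar> * F \<le> s\<^sub>0"
    define s where "s = \<bar>\<theta>\<bar> * F"
    have s: "0 < s" "s \<le> s\<^sub>0" "s \<le> 1/2" using \<theta> F s0 by (auto simp: s_def)
    define g where "g y = f y - (\<integral>z. f z \<partial>\<pi>)" for y
    have gm[measurable]: "g \<in> borel_measurable borel" unfolding g_def by measurable
    have g2: "\<bar>g y\<bar> \<le> 2 * F" for y
      using kernel_power_deviation_bounds(1)[OF f F fF, of 0 y]
      by (simp add: g_def integral_return)
    obtain u where u[measurable]: "u \<in> borel_measurable borel"
      and u_le: "\<And>x. \<bar>u x\<bar> \<le> F * B * sqrt (V x)"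
      and u_Q: "\<And>x. \<bar>(\<integral>y. g y + u y \<partial>Q x) - u x\<bar> \<le> s * (F * B0 * sqrt (V x))"
      using approximate_poisson_solution[OF f F fF s(1), folded B0_def, folded B_def g_def] by metis
    have sqrtV: "1 \<le> sqrt (V x)" "sqrt (V x) \<le> V x" for x
      using V1[of x] mult_left_mono[of 1 "sqrt (V x)" "sqrt (V x)"] by auto
    have U1: "1 \<le> U x" for x using V1[of x] VU[of x] by linarith
    have lu: "\<bar>\<theta> * u x\<bar> \<le> s * B * sqrt (V x)" for x
      using mult_left_mono[OF u_le[of x], of "\<bar>\<theta>\<bar>"] by (simp add: s_def abs_mult mult_ac)
    have lu': "\<bar>\<theta> * u x\<bar> \<le> s * B * V x" for x
      using s B by (intro order_trans[OF lu] mult_left_mono sqrtV) auto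
    have lg: "\<bar>\<theta> * g x\<bar> \<le> 2 * s" for x
      using mult_left_mono[OF g2[of x], of "\<bar>\<theta>\<bar>"] by (simp add: s_def abs_mult mult_ac)
    define W where "W x = 1 + \<theta> * u x + A * s\<^sup>2 * U x" for x
    have Wm: "W \<in> borel_measurable borel" unfolding W_def by measurable
    have W_ge: "1/2 \<le> W x" for x
    proof -
      \<comment> \<open>This is where the square root of \<open>V\<close> pays off: the square
        produced here is linear in \<open>V\<close>, hence dominated by the term
        \<open>A * s\<^sup>2 * U x\<close> of \<open>W\<close>.\<close>
      have "s * B * sqrt (V x) \<le> 1/2 + (s * B * sqrt (V x))\<^sup>2 / 2"
        using sum_squares_bound[of 1 "s * B * sqrt (V x)"] by simp
      also have "(s * B * sqrt (V x))\<^sup>2 = B\<^sup>2 * s\<^sup>2 * V x"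
        using V1[of x] by (simp add: power_mult_distrib)
      also have "\<dots> \<le> A * s\<^sup>2 * U x"
        using A VU[of x] V1[of x] by (intro mult_mono) auto
      finally have "s * B * sqrt (V x) \<le> 1/2 + A * s\<^sup>2 * U x / 2" by simp
      moreover have "0 \<le> A * s\<^sup>2 * U x" using A U1[of x] by simp
      ultimately show ?thesis using lu[of x] unfolding W_def by linarith
    qed
    have W_le: "W x \<le> (1 + B + A * C) * V x" for x
    proof -
      have "s * B * V x \<le> 1 * B * V x"
        using s B V1[of x] by (intro mult_right_mono) auto
      moreover have "A * s\<^sup>2 * U x \<le> A * 1 * (C * V x)"
        using A s U1[of x] UV[of x] by (intro mult_mono) (auto simp: power_le_one)
      ultimately show ?thesis
        using lu'[of x] V1[of x] unfolding W_def by (simp add: algebra_simps)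
    qed
    have W_step: "(\<integral>\<^sup>+y. ennreal (exp (\<theta> * g y)) * ennreal (W y) \<partial>Q x)
        \<le> ennreal (exp (c * s\<^sup>2)) * ennreal (W x)" for x
    proof -
      interpret Qx: prob_space "Q x" by (rule prob_space_Q)
      let ?Z = "\<lambda>y. 1 + \<theta> * (g y + u y) + s\<^sup>2 * (D + A * E) * U y"
      have dom: "exp (\<theta> * g y) * W y \<le> ?Z y" for y
      proof -
        have "exp (\<theta> * g y) * W y \<le> 1 + (\<theta> * g y + \<theta> * u y) + s\<^sup>2 * (D + A * exp (2 * s)) * U y"
          unfolding W_def D_def
          by (rule exp_perturbation_bound[OF lg lu']) (use s V1 VU B A in auto)
        moreover have "s\<^sup>2 * (D + A * exp (2 * s)) * U y \<le> s\<^sup>2 * (D + A * E) * U y"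
          using s A U1[of y]
          by (intro mult_right_mono mult_left_mono add_left_mono) (auto simp: E_def)
        ultimately show ?thesis by (simp add: algebra_simps)
      qed
      have pos: "0 \<le> exp (\<theta> * g y) * W y" for y
        using W_ge[of y] by (intro mult_nonneg_nonneg) auto
      have iU: "integrable (Q x) U"
      proof (rule integrable_Q_of_le_V[OF U])
        show "\<bar>U y\<bar> \<le> C * V y" for y using U1[of y] UV[of y] by simp
      qed
      have igu: "integrable (Q x) (\<lambda>y. g y + u y)"
      proof (rule integrable_Q_of_le_V[where c="2 * F + F * B"])
        fix y
        have "2 * F \<le> 2 * F * V y" using F V1[of y] by simp
        moreover have "F * B * sqrt (V y) \<le> F * B * V y"
          using F B by (intro mult_left_mono sqrtV) auto
        ultimately show "\<bar>g y + u y\<bar> \<le> (2 * F + F * B) * V y"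
          using g2[of y] u_le[of y] by (simp add: algebra_simps)
      qed measurable
      have iZ: "integrable (Q x) ?Z"
        by (intro Bochner_Integration.integrable_add integrable_mult_right iU igu) simp
      have "(\<integral>\<^sup>+y. ennreal (exp (\<theta> * g y)) * ennreal (W y) \<partial>Q x) \<le> (\<integral>\<^sup>+y. ennreal (?Z y) \<partial>Q x)"
        using dom by (intro nn_integral_mono) (simp add: ennreal_mult'[symmetric] ennreal_leI)
      \<comment> \<open>\<open>?Z\<close> is nonnegative because it dominates a nonnegative
        function.\<close>
      also have "\<dots> = ennreal (\<integral>y. ?Z y \<partial>Q x)"
        by (rule nn_integral_eq_integral[OF iZ]) (intro AE_I2 order_trans[OF pos dom])
      also have "(\<integral>y. ?Z y \<partial>Q x) = 1 + \<theta> * (\<integral>y. g y + u y \<partial>Q x) + s\<^sup>2 * (D + A * E) * (\<integral>y. U y \<partial>Q x)"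
        using iU igu by (simp add: Qx.prob_space)
      also have "\<dots> \<le> exp (c * s\<^sup>2) * W x"
      proof -
        have "\<theta> * ((\<integral>y. g y + u y \<partial>Q x) - u x) \<le> \<bar>\<theta>\<bar> * (s * (F * B0 * sqrt (V x)))"
          using mult_left_mono[OF u_Q[of x], of "\<bar>\<theta>\<bar>"]
            abs_ge_self[of "\<theta> * ((\<integral>y. g y + u y \<partial>Q x) - u x)"] by (simp add: abs_mult)
        also have "\<dots> = s\<^sup>2 * B0 * sqrt (V x)" by (simp add: s_def power2_eq_square)
        also have "\<dots> \<le> s\<^sup>2 * B0 * U x"
          using B0 sqrtV(2)[of x] VU[of x] by (intro mult_left_mono) auto
        finally have 1: "\<theta> * (\<integral>y. g y + u y \<partial>Q x) \<le> \<theta> * u x + s\<^sup>2 * B0 * U x"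
          by (simp add: algebra_simps)
        have DAE: "0 \<le> D + A * E" using D A by (simp add: E_def)
        have 2: "s\<^sup>2 * (D + A * E) * (\<integral>y. U y \<partial>Q x) \<le> s\<^sup>2 * (D + A * E) * (\<rho> * U x + b)"
          using DAE drift by (intro mult_left_mono) auto
        \<comment> \<open>The coefficient of \<open>s\<^sup>2 * U x\<close> collects the Poisson
          error and the contracted expansion term; the choices of \<open>A\<close> and
          \<open>s\<^sub>0\<close> close the estimate.\<close>
        have 3: "B0 + (D + A * E) * \<rho> \<le> A"
        proof -
          have "A * (E * \<rho>) \<le> A * ((1 + \<rho>) / 2)"
            using A exp_s0 by (intro mult_left_mono) (auto simp: E_def)
          moreover have "D * \<rho> \<le> D" using D \<rho> by simp
          ultimately show ?thesis using A2 by (simp add: field_simps)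
        qed
        have "1 + \<theta> * (\<integral>y. g y + u y \<partial>Q x) + s\<^sup>2 * (D + A * E) * (\<integral>y. U y \<partial>Q x)
          \<le> 1 + \<theta> * u x + s\<^sup>2 * U x * (B0 + (D + A * E) * \<rho>) + s\<^sup>2 * (D + A * E) * b"
          using 1 2 by (simp add: algebra_simps)
        also have "\<dots> \<le> 1 + \<theta> * u x + s\<^sup>2 * U x * A + s\<^sup>2 * (D + A * E) * b"
          using 3 U1[of x] by (intro add_left_mono add_right_mono mult_left_mono) auto
        also have "\<dots> = W x + s\<^sup>2 * (2 * (D + A * E) * b) * (1/2)"
          by (simp add: W_def)
        also have "\<dots> \<le> W x + s\<^sup>2 * c * W x"
          using W_ge[of x] DAE b c by (intro add_left_mono mult_mono) (auto simp: c_def)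
        also have "\<dots> = (1 + c * s\<^sup>2) * W x" by (simp add: algebra_simps)
        also have "\<dots> \<le> exp (c * s\<^sup>2) * W x"
          using W_ge[of x] by (intro mult_right_mono exp_ge_add_one_self) auto
        finally show ?thesis .
      qed
      finally show ?thesis
        using W_ge[of x] by (simp add: ennreal_mult' ennreal_leI)
    qed
    show "\<exists>W \<in> borel_measurable borel. (\<forall>x. 1/2 \<le> W x \<and> W x \<le> (1 + B + A * C) * V x) \<and>
        (\<forall>x. (\<integral>\<^sup>+y. ennreal (exp (\<theta> * (f y - (\<integral>z. f z \<partial>\<pi>)))) * ennreal (W y) \<partial>Q x)
          \<le> ennreal (exp (c * (\<bar>\<theta>\<bar> * F)\<^sup>2)) * ennreal (W x))"
      using Wm W_ge W_le W_step unfolding g_def s_def by (intro bexI[of _ W]) auto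
  qed
qed

end

subsection \<open>Chernoff's bound\<close>

lemma exp_neg_ennreal: "0 \<le> r \<Longrightarrow> exp_neg (ennreal r) = ennreal (exp (- r))"
  by (simp add: exp_neg_def)

lemma abs_le_sup_norm: "bounded (range f) \<Longrightarrow> \<bar>f x\<bar> \<le> sup_norm f"
  unfolding sup_norm_def
  by (intro cSUP_upper) (auto simp: bounded_iff bdd_above_def)

lemma bernstein_rate_eq:
  assumes "0 < sup_norm f" "0 < t" "1 \<le> n"
  shows "bernstein_rate f n t = ennreal (min (t\<^sup>2 / (real n * (sup_norm f)\<^sup>2)) (t / sup_norm f))"
  using assms unfolding bernstein_rate_def
  by (subst (1 2) divide_ennreal) (auto simp: min_def ennreal_le_iff)

text \<open>On the event, one of the two exponentials is at least \<open>exp (\<theta> * t)\<close>,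
  so their sum bounds both tails at once. The bound \<open>b\<close> may be infinite.\<close>

lemma two_sided_chernoff:
  assumes S: "S \<in> borel_measurable M" and pos: "0 < \<theta>"
    and "(\<integral>\<^sup>+\<omega>. ennreal (exp (\<theta> * S \<omega>)) \<partial>M) \<le> b"
    and "(\<integral>\<^sup>+\<omega>. ennreal (exp (- \<theta> * S \<omega>)) \<partial>M) \<le> b"
  shows "emeasure M {\<omega> \<in> space M. t \<le> \<bar>S \<omega>\<bar>} \<le> ennreal (exp (- \<theta> * t)) * (2 * b)"
proof -
  note [measurable] = S
  have "emeasure M {\<omega> \<in> space M. t \<le> \<bar>S \<omega>\<bar>}
      = (\<integral>\<^sup>+\<omega>. indicator {\<omega> \<in> space M. t \<le> \<bar>S \<omega>\<bar>} \<omega> \<partial>M)"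
    by (rule nn_integral_indicator[symmetric]) measurable
  also have "\<dots> \<le> (\<integral>\<^sup>+\<omega>. ennreal (exp (- \<theta> * t)) *
      (ennreal (exp (\<theta> * S \<omega>)) + ennreal (exp (- \<theta> * S \<omega>))) \<partial>M)"
  proof (rule nn_integral_mono)
    fix \<omega>
    have "1 \<le> exp (- \<theta> * t) * (exp (\<theta> * S \<omega>) + exp (- \<theta> * S \<omega>))" if "t \<le> \<bar>S \<omega>\<bar>"
    proof -
      have "exp (\<theta> * t) \<le> exp (\<theta> * \<bar>S \<omega>\<bar>)" using that pos by simp
      also have "\<dots> \<le> exp (\<theta> * S \<omega>) + exp (- \<theta> * S \<omega>)"
        by (cases "0 \<le> S \<omega>") (simp_all add: less_imp_le)
      finally show ?thesis by (simp add: exp_minus field_simps)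
    qed
    then show "indicator {\<omega> \<in> space M. t \<le> \<bar>S \<omega>\<bar>} \<omega>
      \<le> ennreal (exp (- \<theta> * t)) * (ennreal (exp (\<theta> * S \<omega>)) + ennreal (exp (- \<theta> * S \<omega>)))"
      by (auto simp: indicator_def ennreal_mult'[symmetric] simp flip: ennreal_plus)
  qed
  also have "\<dots> = ennreal (exp (- \<theta> * t)) *
      ((\<integral>\<^sup>+\<omega>. ennreal (exp (\<theta> * S \<omega>)) \<partial>M) + (\<integral>\<^sup>+\<omega>. ennreal (exp (- \<theta> * S \<omega>)) \<partial>M))"
    by (subst nn_integral_cmult, measurable) (simp add: nn_integral_add)
  also have "\<dots> \<le> ennreal (exp (- \<theta> * t)) * (2 * b)"
    unfolding mult_2 using assms(3,4) by (intro mult_left_mono add_mono) auto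
  finally show ?thesis .
qed

section \<open>Exponential moments along the chain\<close>

context ergodic_kernel begin

text \<open>The lower bound 1/2 on \<open>W\<close> allows it to be inserted at time
  \<open>n\<close> at the cost of a factor 2, and the upper bound \<open>C * V\<close> controls its
  integral under the initial law, even if that integral is infinite.\<close>

lemma exponential_moment_bound:
  obtains s\<^sub>0 c C where "0 < s\<^sub>0" "0 < c" "0 < C"
    "\<And>f F \<theta> M X \<eta> n. \<lbrakk>markov_chain (M :: 'w measure) X Q \<eta>; f \<in> borel_measurable borel;
        0 < F; \<And>x. \<bar>f x\<bar> \<le> F; \<theta> \<noteq> 0; \<bar>\<theta>\<bar> * F \<le> s\<^sub>0\<rbrakk> \<Longrightarrow>
      (\<integral>\<^sup>+\<omega>. ennreal (exp (\<theta> * (\<Sum>i=1..n. (f (X i \<omega>) - (\<integral>x. f x \<partial>\<pi>))))) \<partial>M)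
        \<le> ennreal (C * exp (c * (\<bar>\<theta>\<bar> * F)\<^sup>2 * real n)) * (\<integral>\<^sup>+x. ennreal (V x) \<partial>\<eta>)"
proof (rule exponential_supermartingale)
  fix s\<^sub>0 c C :: real
  assume pos: "0 < s\<^sub>0" "0 < c" "0 < C"
    and super: "\<And>f F \<theta>. \<lbrakk>f \<in> borel_measurable borel; 0 < F; \<And>x. \<bar>f x\<bar> \<le> F; \<theta> \<noteq> 0; \<bar>\<theta>\<bar> * F \<le> s\<^sub>0\<rbrakk> \<Longrightarrow>
      \<exists>W \<in> borel_measurable borel. (\<forall>x. 1/2 \<le> W x \<and> W x \<le> C * V x) \<and>
        (\<forall>x. (\<integral>\<^sup>+y. ennreal (exp (\<theta> * (f y - (\<integral>z. f z \<partial>\<pi>)))) * ennreal (W y) \<partial>Q x)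
          \<le> ennreal (exp (c * (\<bar>\<theta>\<bar> * F)\<^sup>2)) * ennreal (W x))"
  show thesis
  proof (rule that[of s\<^sub>0 c "2 * C", OF pos(1,2)])
    show "0 < 2 * C" using pos by simp
    fix f :: "'a \<Rightarrow> real" and F \<theta> :: real and M :: "'w measure" and X \<eta> and n :: nat
    assume mc: "markov_chain M X Q \<eta>" and f: "f \<in> borel_measurable borel" and F: "0 < F"
      and fF: "\<And>x. \<bar>f x\<bar> \<le> F" and \<theta>: "\<theta> \<noteq> 0" "\<bar>\<theta>\<bar> * F \<le> s\<^sub>0"
    obtain W where W: "W \<in> borel_measurable borel" "\<And>x. 1/2 \<le> W x" "\<And>x. W x \<le> C * V x"
      and step: "\<And>x. (\<integral>\<^sup>+y. ennreal (exp (\<theta> * (f y - (\<integral>z. f z \<partial>\<pi>)))) * ennreal (W y) \<partial>Q x)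
          \<le> ennreal (exp (c * (\<bar>\<theta>\<bar> * F)\<^sup>2)) * ennreal (W x)"
      using super[OF f F fF \<theta>] by blast
    have X: "\<And>n. X n \<in> M \<rightarrow>\<^sub>M borel" and eta: "distr M borel (X 0) = \<eta>"
      using mc by (auto simp: markov_chain_def)
    have eta_sets: "sets \<eta> = sets borel" using eta by auto
    note [measurable] = f W(1) X
    let ?g = "\<lambda>y. \<theta> * (f y - (\<integral>z. f z \<partial>\<pi>))"
    let ?a = "exp (c * (\<bar>\<theta>\<bar> * F)\<^sup>2)"
    have gb: "?g y \<le> \<bar>\<theta>\<bar> * (F + \<bar>\<integral>z. f z \<partial>\<pi>\<bar>)" for y
    proof -
      have "?g y \<le> \<bar>\<theta>\<bar> * \<bar>f y - (\<integral>z. f z \<partial>\<pi>)\<bar>"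
        using abs_ge_self[of "?g y"] by (simp add: abs_mult)
      also have "\<dots> \<le> \<bar>\<theta>\<bar> * (F + \<bar>\<integral>z. f z \<partial>\<pi>\<bar>)"
        using fF[of y] by (intro mult_left_mono) auto
      finally show ?thesis .
    qed
    have "(\<integral>\<^sup>+\<omega>. ennreal (exp (\<theta> * (\<Sum>i=1..n. (f (X i \<omega>) - (\<integral>x. f x \<partial>\<pi>))))) \<partial>M)
      \<le> (\<integral>\<^sup>+\<omega>. 2 * (ennreal (exp (\<Sum>i=1..n. ?g (X i \<omega>))) * ennreal (W (X n \<omega>))) \<partial>M)"
    proof (rule nn_integral_mono)
      fix \<omega>
      have "exp (\<Sum>i=1..n. ?g (X i \<omega>)) * 1 \<le> exp (\<Sum>i=1..n. ?g (X i \<omega>)) * (2 * W (X n \<omega>))"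
        using W(2)[of "X n \<omega>"] by (intro mult_left_mono) auto
      then have "ennreal (exp (\<Sum>i=1..n. ?g (X i \<omega>)))
          \<le> ennreal (2 * (exp (\<Sum>i=1..n. ?g (X i \<omega>)) * W (X n \<omega>)))"
        by (intro ennreal_leI) (simp add: mult_ac)
      then show "ennreal (exp (\<theta> * (\<Sum>i=1..n. (f (X i \<omega>) - (\<integral>x. f x \<partial>\<pi>)))))
          \<le> 2 * (ennreal (exp (\<Sum>i=1..n. ?g (X i \<omega>))) * ennreal (W (X n \<omega>)))"
        by (simp add: ennreal_mult' sum_distrib_left)
    qed
    also have "\<dots> = 2 * (\<integral>\<^sup>+\<omega>. ennreal (exp (\<Sum>i=1..n. ?g (X i \<omega>))) * ennreal (W (X n \<omega>)) \<partial>M)"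
      by (rule nn_integral_cmult) measurable
    also have "\<dots> \<le> 2 * (ennreal (?a ^ n) * (\<integral>\<^sup>+x. ennreal (W x) \<partial>\<eta>))"
      by (intro mult_left_mono markov_chain_exponential_moment[OF Q mc _ gb _ _ step]) auto
    also have "\<dots> \<le> 2 * (ennreal (?a ^ n) * (\<integral>\<^sup>+x. ennreal C * ennreal (V x) \<partial>\<eta>))"
      using W(3) pos by (intro mult_left_mono nn_integral_mono)
        (auto simp: ennreal_mult'[symmetric] intro!: ennreal_leI)
    also have "\<dots> = 2 * (ennreal (?a ^ n) * (ennreal C * (\<integral>\<^sup>+x. ennreal (V x) \<partial>\<eta>)))"
      using eta_sets by (subst nn_integral_cmult) (auto cong: measurable_cong_sets)
    also have "\<dots> = ennreal (2 * C * exp (c * (\<bar>\<theta>\<bar> * F)\<^sup>2 * real n)) * (\<integral>\<^sup>+x. ennreal (V x) \<partial>\<eta>)"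
      using pos by (simp add: ennreal_mult' mult_ac flip: exp_of_nat_mult)
    finally show "(\<integral>\<^sup>+\<omega>. ennreal (exp (\<theta> * (\<Sum>i=1..n. (f (X i \<omega>) - (\<integral>x. f x \<partial>\<pi>))))) \<partial>M)
        \<le> ennreal (2 * C * exp (c * (\<bar>\<theta>\<bar> * F)\<^sup>2 * real n)) * (\<integral>\<^sup>+x. ennreal (V x) \<partial>\<eta>)" .
  qed
qed

end

section \<open>Choice of the exponential parameter and conclusion\<close>

theorem theorem17:
  fixes V :: "'a::polish_space \<Rightarrow> real"
    and Q :: "'a \<Rightarrow> 'a measure"
    and \<pi> :: "'a measure"
  assumes "markov_kernel Q"
    and "V \<in> borel_measurable borel"
    and "\<And>x. 1 \<le> V x"
    and "V_uniformly_ergodic V Q"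
    and "invariant_prob Q \<pi>"
  shows "\<exists>K::real. 0 < K \<and>
    (\<forall>(\<eta>::'a measure) (M::'w measure) (X::nat \<Rightarrow> 'w \<Rightarrow> 'a) (f::'a \<Rightarrow> real) (t::real) (n::nat).
      \<eta> \<in> space (prob_algebra borel) \<longrightarrow> markov_chain M X Q \<eta> \<longrightarrow>
      f \<in> borel_measurable borel \<longrightarrow> bounded (range f) \<longrightarrow> 0 < t \<longrightarrow> 1 \<le> n \<longrightarrow>
      emeasure M {\<omega> \<in> space M. t \<le> \<bar>\<Sum>i=1..n. (f (X i \<omega>) - (\<integral>x. f x \<partial>\<pi>))\<bar>}
        \<le> ennreal K * (\<integral>\<^sup>+x. ennreal (V x) \<partial>\<eta>)
            * exp_neg (ennreal (1 / K) * bernstein_rate f n t))"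
proof -
  \<comment> \<open>Ergodicity gives the rate for some invariant law; uniqueness identifies it with
    the given \<open>\<pi>\<close>.\<close>
  obtain R \<alpha> where "0 \<le> R" "1 < (\<alpha>::real)"
    "\<And>x m. V_norm V (kernel_power Q m x) \<pi> \<le> ennreal (R / \<alpha> ^ m * V x)"
    using assms(4) invariant_prob_unique[OF assms(1,3,4)] assms(5)
    unfolding V_uniformly_ergodic_def by metis
  then interpret ergodic_kernel V Q \<pi> R \<alpha>
    using assms by unfold_locales auto
  show ?thesis
  proof (rule exponential_moment_bound[where 'w='w])
    fix s\<^sub>0 c C :: real
    assume pos: "0 < s\<^sub>0" "0 < c" "0 < C"
      and moment: "\<And>f F \<theta> M X \<eta> n. \<lbrakk>markov_chain (M :: 'w measure) X Q \<eta>; f \<in> borel_measurable borel;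
          0 < F; \<And>x. \<bar>f x\<bar> \<le> F; \<theta> \<noteq> 0; \<bar>\<theta>\<bar> * F \<le> s\<^sub>0\<rbrakk> \<Longrightarrow>
        (\<integral>\<^sup>+\<omega>. ennreal (exp (\<theta> * (\<Sum>i=1..n. (f (X i \<omega>) - (\<integral>x. f x \<partial>\<pi>))))) \<partial>M)
          \<le> ennreal (C * exp (c * (\<bar>\<theta>\<bar> * F)\<^sup>2 * real n)) * (\<integral>\<^sup>+x. ennreal (V x) \<partial>\<eta>)"
    \<comment> \<open>The three entries absorb the prefactor \<open>2 * C\<close>, the linear regime
      where \<open>\<theta>\<close> is capped at \<open>s\<^sub>0 / F\<close>, and the quadratic
      regime.\<close>
    define K where "K = max (2 * C) (max (2 / s\<^sub>0) (4 * c))"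
    have K: "0 < K" "2 * C \<le> K" "2 / s\<^sub>0 \<le> K" "4 * c \<le> K"
      using pos by (auto simp: K_def)
    show ?thesis
    proof (intro exI[of _ K] conjI allI impI, rule K(1))
      fix \<eta> and M :: "'w measure" and X and f :: "'a \<Rightarrow> real" and t :: real and n :: nat
      assume mc: "markov_chain M X Q \<eta>" and f: "f \<in> borel_measurable borel"
        and fb: "bounded (range f)" and t: "0 < t" and n: "1 \<le> n"
      define F where "F = sup_norm f"
      have fF: "\<bar>f x\<bar> \<le> F" for x unfolding F_def by (rule abs_le_sup_norm[OF fb])
      have F0: "0 \<le> F" using fF[of undefined] by simp
      have X: "\<And>n. X n \<in> M \<rightarrow>\<^sub>M borel" using mc by (auto simp: markov_chain_def)
      note [measurable] = f X
      let ?S = "\<lambda>\<omega>. \<Sum>i=1..n. (f (X i \<omega>) - (\<integral>x. f x \<partial>\<pi>))"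
      let ?V = "\<integral>\<^sup>+x. ennreal (V x) \<partial>\<eta>"
      show "emeasure M {\<omega> \<in> space M. t \<le> \<bar>?S \<omega>\<bar>}
          \<le> ennreal K * ?V * exp_neg (ennreal (1 / K) * bernstein_rate f n t)"
      proof (cases "F = 0")
        case True
        \<comment> \<open>Here the sum vanishes and \<open>t\<close> is positive, so the event is
          empty, in accordance with the infinite rate.\<close>
        then have "f x = 0" for x using fF[of x] by simp
        then show ?thesis using t by simp
      next
        case False
        then have F: "0 < F" using F0 by simp
        \<comment> \<open>The second entry minimises
          \<open>c * (\<theta> * F)\<^sup>2 * real n - \<theta> * t\<close> over
          \<open>\<theta>\<close>; the first is the largest value for which the moment bound is
          available. In either case the quadratic term is at most half of
          \<open>\<theta> * t\<close>.\<close>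
        define \<theta> where "\<theta> = min (s\<^sub>0 / F) (t / (2 * c * real n * F\<^sup>2))"
        have \<theta>: "0 < \<theta>" "\<bar>\<theta>\<bar> * F \<le> s\<^sub>0"
          using pos F t n by (auto simp: \<theta>_def abs_real_def min_def field_simps)
        let ?b = "ennreal (C * exp (c * (\<theta> * F)\<^sup>2 * real n)) * ?V"
        have "emeasure M {\<omega> \<in> space M. t \<le> \<bar>?S \<omega>\<bar>} \<le> ennreal (exp (- \<theta> * t)) * (2 * ?b)"
        proof (rule two_sided_chernoff[OF _ \<theta>(1)])
          show "?S \<in> borel_measurable M" by measurable
          show "(\<integral>\<^sup>+\<omega>. ennreal (exp (\<theta> * ?S \<omega>)) \<partial>M) \<le> ?b"
            using moment[OF mc f F fF, of \<theta> n] \<theta> by simp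
          show "(\<integral>\<^sup>+\<omega>. ennreal (exp (- \<theta> * ?S \<omega>)) \<partial>M) \<le> ?b"
            using moment[OF mc f F fF, of "- \<theta>" n] \<theta> by simp
        qed
        also have "\<dots> = ennreal (2 * C * exp (c * (\<theta> * F)\<^sup>2 * real n - \<theta> * t)) * ?V"
        proof -
          have "2 * C * exp (c * (\<theta> * F)\<^sup>2 * real n - \<theta> * t)
              = exp (- \<theta> * t) * (2 * (C * exp (c * (\<theta> * F)\<^sup>2 * real n)))"
            by (simp add: exp_diff exp_minus field_simps)
          then show ?thesis using pos by (simp add: ennreal_mult' mult_ac)
        qed
        also have "\<dots> \<le> ennreal (K * exp (- (1 / K * min (t\<^sup>2 / (real n * F\<^sup>2)) (t / F)))) * ?V"
        proof (intro mult_right_mono ennreal_leI mult_mono)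
          have "c * (\<theta> * F)\<^sup>2 * real n = \<theta> * (\<theta> * (c * real n * F\<^sup>2))"
            by (simp add: power2_eq_square)
          also have "\<dots> \<le> \<theta> * (t / 2)"
          proof (intro mult_left_mono)
            have "\<theta> * (c * real n * F\<^sup>2) \<le> t / (2 * c * real n * F\<^sup>2) * (c * real n * F\<^sup>2)"
              using pos by (intro mult_right_mono) (auto simp: \<theta>_def)
            also have "\<dots> = t / 2" using pos F n by simp
            finally show "\<theta> * (c * real n * F\<^sup>2) \<le> t / 2" .
          qed (use \<theta> in simp)
          finally have 1: "c * (\<theta> * F)\<^sup>2 * real n - \<theta> * t \<le> - (\<theta> * t / 2)" by simp
          \<comment> \<open>The two possible values of \<open>\<theta>\<close> make
            \<open>\<theta> * t / 2\<close> a multiple of one argument of the minimum, with factor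
            \<open>s\<^sub>0 / 2\<close> or \<open>1 / (4 * c)\<close>; \<open>1 / K\<close> is
            below both factors.\<close>
          have "1 / K * min (t\<^sup>2 / (real n * F\<^sup>2)) (t / F) \<le> \<theta> * t / 2"
          proof -
            let ?m = "min (t\<^sup>2 / (real n * F\<^sup>2)) (t / F)"
            have m0: "0 \<le> ?m" using t F by simp
            have "1 / K * ?m \<le> s\<^sub>0 / 2 * (t / F)"
              using K pos t F m0 by (intro mult_mono) (auto simp: field_simps)
            moreover have "1 / K * ?m \<le> 1 / (4 * c) * (t\<^sup>2 / (real n * F\<^sup>2))"
              using K pos t F m0 by (intro mult_mono) (auto simp: field_simps)
            moreover have "\<theta> = s\<^sub>0 / F \<or> \<theta> = t / (2 * c * real n * F\<^sup>2)"
              by (simp add: \<theta>_def min_def)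
            then have "\<theta> * t / 2 = s\<^sub>0 / 2 * (t / F) \<or> \<theta> * t / 2 = 1 / (4 * c) * (t\<^sup>2 / (real n * F\<^sup>2))"
              by (auto simp: power2_eq_square)
            ultimately show ?thesis by linarith
          qed
          with 1 show "exp (c * (\<theta> * F)\<^sup>2 * real n - \<theta> * t)
              \<le> exp (- (1 / K * min (t\<^sup>2 / (real n * F\<^sup>2)) (t / F)))"
            by simp
        qed (use K in auto)
        also have "\<dots> = ennreal K * ?V * exp_neg (ennreal (1 / K) * bernstein_rate f n t)"
        proof -
          have "ennreal (1 / K) * bernstein_rate f n t
              = ennreal (1 / K * min (t\<^sup>2 / (real n * F\<^sup>2)) (t / F))"
            using F t n K by (simp add: bernstein_rate_eq F_def ennreal_mult'[symmetric])
            moreover have "0 \<le> 1 / K * min (t\<^sup>2 / (real n * F\<^sup>2)) (t / F)"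
            using K(1) t F by simp
          ultimately have "exp_neg (ennreal (1 / K) * bernstein_rate f n t)
              = ennreal (exp (- (1 / K * min (t\<^sup>2 / (real n * F\<^sup>2)) (t / F))))"
            by (simp only: exp_neg_ennreal)
          then show ?thesis
            using K(1) by (simp only: ennreal_mult' less_imp_le mult_ac)
        qed
        finally show ?thesis .
      qed
    qed
  qed
qed

end
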